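(* Let $\mathcal G=(V,E,\mathfrak c)$ be a countably infinite connected graph with conductances such that $\pi(x)=\sum_{y\sim x}\mathfrak c(x,y)<\infty$ for all $x\in V$, let $\mathcal A\subset V$ be non-empty and finite, and let $G_{\mathcal A}$ be the Green's function for random walk on $\mathcal G$ reflected off of infinity and killed upon hitting $\mathcal A$. For each $x,y\in V$, $$\frac{G_{\mathcal A}(x,y)}{\pi(y)}=\frac{G_{\mathcal A}(y,x)}{\pi(x)}.$$ Furthermore, for any function $f:V\to\mathbb R$ which vanishes outside of a finite set, $$\sum_{x,y\in V}f(x)f(y)\frac{G_{\mathcal A}(x,y)}{\pi(y)}\ge0.$$
   Context: $\mathcal G=(V,E,\mathfrak c)$ is a graph with vertex set $V$, set $E$ of unoriented edges (unordered pairs of distinct vertices) and conductance function $\mathfrak c:E\to(0,\infty)$. Write $x\sim y$ if $x$ and $y$ are joined by an edge, in which case $\mathfrak c(x,y)=\mathfrak c(y,x)$ is its conductance. Vertices may have infinite degree. Energy-minimizing functions. $\operatorname{Energy}(f)=\sum_{\{x,y\}\in E}\mathfrak c(x,y)|f(y)-f(x)|^2$. For each non-empty finite $\mathcal A\subset V$ and $\phi:\mathcal A\to\mathbb R$ there is a unique $h^\phi:V\to\mathbb R$ with $h^\phi|_{\mathcal A}=\phi$ of minimal energy among all functions $f:V\to\mathbb R$ with $f|_{\mathcal A}=\phi$. Random walk reflected off of infinity. There is a function $\mathfrak w_*:V\to(0,\infty)$ such that for every $\mathfrak w:V\to(0,\infty)$ with $\mathfrak w\ge\mathfrak w_*$ pointwise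 there is a unique (in law) family of processes $X:[0,\infty)\to V\cup\{\infty\}$, started from $X_0=z$ for each $z\in V$ (law $\mathbb P_z$), such that: (i) for each $t\ge0$, a.s. $X_t\in V$ and $X$ is constant on a neighbourhood of $t$ in $[0,\infty)$; (ii) a.s., for every $t\ge 0$ with $X_t\in V$ there is $\varepsilon>0$ with $X_s=X_t$ for all $s\in[t,t+\varepsilon]$; (iii) with $\tau=\min\{t>0:X_t\ne z\}$, $\tau$ and $X_\tau$ are independent, $\tau$ is exponential with rate $\mathfrak w(z)$, and $\mathbb P_z[X_\tau=x]=\mathfrak c(z,x)/\pi(z)$ for $x\sim z$; (iv) for $t\ge0$ and $x\in V$, on $\{X_t=x\}$ the conditional law of $\{X_{s+t}\}_{s\ge0}$ given $\{X_s\}_{s\le t}$ is the law of $X$ under $\mathbb P_x$; (v) a.s. there are arbitrarily large $t$ with $X_t=z$; (vi) for every non-empty finite $\mathcal A\subset V$, $\phi:\mathcal A\to\mathbb R$ and $z\in V$, with $\tau=\min\{t\ge0:X_t\in\mathcal A\}$, $h^\phi(z)=\mathbb E_z[\phi(X_\tau)]$. Fix such $\mathfrak w_*$ and $\mathfrak w\ge\mathfrak w_*$; $X$ denotes this process. Green's function. For a non-empty finite $\mathcal A\subset V$ let $\tau_{\mathcal A}=\min\{t\ge0:X_t\in\mathcal A\}$, and for $y\in V$ let $N_{\mathcal A}(y)$ be the number of distinct visits of $X$ to $y$ strictly before time $\tau_{\mathcal A}$, i.e. the number of connected components of $X^{-1}(y)\cap[0,\tau_{\mathcal A})$. Then $G_{\mathcal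 A}(x,y)=\mathbb E_x[N_{\mathcal A}(y)]$. *)

theory Defs
  imports "HOL-Probability.Probability"
begin

section \<open>Graphs with conductances\<close>

text \<open>
  The vertex set is the whole type \<open>'v\<close>; edges are unordered pairs of distinct vertices,
  and the conductance is a function of the edge.
\<close>

locale conductance_graph =
  fixes E :: "'v set set" and c :: "'v set \<Rightarrow> real"
  assumes edges: "e \<in> E \<Longrightarrow> \<exists>x y. x \<noteq> y \<and> e = {x, y}"
    and conductance_pos: "e \<in> E \<Longrightarrow> 0 < c e"

definition adj :: "'v set set \<Rightarrow> 'v \<Rightarrow> 'v \<Rightarrow> bool" where
  "adj E x y \<longleftrightarrow> {x, y} \<in> E"

definition connected_graph :: "'v set set \<Rightarrow> bool" where
  "connected_graph E \<longleftrightarrow> (\<forall>x y. (adj E)\<^sup>*\<^sup>* x y)"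

definition finite_conductance_at :: "'v set set \<Rightarrow> ('v set \<Rightarrow> real) \<Rightarrow> 'v \<Rightarrow> bool" where
  "finite_conductance_at E c x \<longleftrightarrow> (\<lambda>y. c {x, y}) summable_on {y. adj E x y}"

definition total_conductance :: "'v set set \<Rightarrow> ('v set \<Rightarrow> real) \<Rightarrow> 'v \<Rightarrow> real" where
  "total_conductance E c x = (\<Sum>\<^sub>\<infinity>y\<in>{y. adj E x y}. c {x, y})"


section \<open>Energy-minimizing functions\<close>

definition edge_diff :: "('v \<Rightarrow> real) \<Rightarrow> 'v set \<Rightarrow> real" where
  "edge_diff f e = (THE d. \<exists>x y. e = {x, y} \<and> d = \<bar>f y - f x\<bar>)"

lemma edge_diff_insert [simp]: "edge_diff f {x, y} = \<bar>f y - f x\<bar>"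
  unfolding edge_diff_def by (rule the_equality) (auto simp: doubleton_eq_iff)

definition energy :: "'v set set \<Rightarrow> ('v set \<Rightarrow> real) \<Rightarrow> ('v \<Rightarrow> real) \<Rightarrow> ennreal" where
  "energy E c f = (\<Sum>\<^sub>\<infinity>e\<in>E. ennreal (c e * (edge_diff f e)\<^sup>2))"

text \<open>The function \<open>h\<^sup>\<phi>\<close>; only the values of \<open>\<phi>\<close> on \<open>A\<close> matter.\<close>

definition energy_min_ext ::
  "'v set set \<Rightarrow> ('v set \<Rightarrow> real) \<Rightarrow> 'v set \<Rightarrow> ('v \<Rightarrow> real) \<Rightarrow> 'v \<Rightarrow> real" where
  "energy_min_ext E c A \<phi> =
     (THE h. (\<forall>a\<in>A. h a = \<phi> a) \<and>
        (\<forall>f. (\<forall>a\<in>A. f a = \<phi> a) \<longrightarrow> energy E c h \<le> energy E c f))"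


section \<open>Random walk reflected off of infinity\<close>

text \<open>
  A path is a function on \<open>[0,\<infinity>)\<close> (extensional, i.e. \<open>undefined\<close> at negative times) with values
  in \<open>V \<union> {\<infinity>}\<close>, where \<open>None\<close> stands for \<open>\<infinity>\<close>.
\<close>

type_synonym 'v path = "real \<Rightarrow> 'v option"

definition path_shift :: "real \<Rightarrow> 'v path \<Rightarrow> 'v path" where
  "path_shift t \<omega> = (\<lambda>s\<in>{0..}. \<omega> (s + t))"

definition past :: "'v path measure \<Rightarrow> real \<Rightarrow> 'v path measure" where
  "past F t =
     vimage_algebra (space F) (\<lambda>\<omega>. restrict \<omega> {0..t}) (\<Pi>\<^sub>M s\<in>{0..t}. count_space UNIV)"

definition has_min :: "real set \<Rightarrow> bool" where
  "has_min S \<longleftrightarrow> (\<exists>m\<in>S. \<forall>s\<in>S. m \<le> s)"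

definition exit_times :: "'v \<Rightarrow> 'v path \<Rightarrow> real set" where
  "exit_times z \<omega> = {t. 0 < t \<and> \<omega> t \<noteq> Some z}"

definition exit_time :: "'v \<Rightarrow> 'v path \<Rightarrow> real" where
  "exit_time z \<omega> = (LEAST t. t \<in> exit_times z \<omega>)"

definition hit_times :: "'v set \<Rightarrow> 'v path \<Rightarrow> real set" where
  "hit_times A \<omega> = {t. 0 \<le> t \<and> \<omega> t \<in> Some ` A}"

definition hit_time :: "'v set \<Rightarrow> 'v path \<Rightarrow> real" where
  "hit_time A \<omega> = (LEAST t. t \<in> hit_times A \<omega>)"

text \<open>
  The process is given by its law \<open>P z\<close> on path space for each starting vertex \<open>z\<close>, so that
  \<open>X\<^sub>t\<close> is the coordinate map \<open>\<lambda>\<omega>. \<omega> t\<close>. The laws live on a common \<open>\<sigma>\<close>-algebra \<open>F\<close> that contains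
  the coordinate \<open>\<sigma>\<close>-algebra and is compatible with time shifts, but need not be the coordinate
  \<open>\<sigma>\<close>-algebra of all paths: on the space of all paths the latter does not see sample path
  properties such as \<open>right_constant\<close> below (an example of a suitable \<open>F\<close> is the trace of the
  coordinate \<open>\<sigma>\<close>-algebra on a shift-invariant set of regular paths). The Markov property
  is required for all events of \<open>F\<close>.

  Exit and hitting times agree only almost surely with \<open>F\<close>-measurable functions; hence the use of
  the completed measures. That the minima defining these times exist almost surely is
  stated explicitly.
\<close>

locale reflected_walk = conductance_graph E c
  for E :: "'v::countable set set" and c :: "'v set \<Rightarrow> real" +
  fixes w :: "'v \<Rightarrow> real" and F :: "'v path measure" and P :: "'v \<Rightarrow> 'v path measure"
  assumes rate_pos: "0 < w z"
    and paths: "space F \<subseteq> extensional {0..}"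
    and coordinate_measurable: "0 \<le> t \<Longrightarrow> (\<lambda>\<omega>. \<omega> t) \<in> F \<rightarrow>\<^sub>M count_space UNIV"
    and shift_measurable: "0 \<le> t \<Longrightarrow> path_shift t \<in> F \<rightarrow>\<^sub>M F"
    and prob_space_P: "prob_space (P z)"
    and sets_P: "sets (P z) = sets F"
    and start: "AE \<omega> in P z. \<omega> 0 = Some z"
    and locally_constant: "0 \<le> t \<Longrightarrow>
      AE \<omega> in P z. \<omega> t \<noteq> None \<and> (\<forall>\<^sub>F s in at t within {0..}. \<omega> s = \<omega> t)"
    and right_constant:
      "AE \<omega> in P z. \<forall>t\<ge>0. \<omega> t \<noteq> None \<longrightarrow> (\<exists>\<epsilon>>0. \<forall>s\<in>{t..t+\<epsilon>}. \<omega> s = \<omega> t)"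
    and exit_time_exists: "AE \<omega> in P z. has_min (exit_times z \<omega>)"
    and exit_indep: "prob_space.indep_set (completion (P z))
      {exit_time z -` B \<inter> space (P z) | B. B \<in> sets borel}
      {(\<lambda>\<omega>. \<omega> (exit_time z \<omega>)) -` B \<inter> space (P z) | B. B \<in> sets (count_space UNIV)}"
    and exit_time_exponential:
      "distributed (completion (P z)) lborel (exit_time z) (exponential_density (w z))"
    and exit_law: "adj E z x \<Longrightarrow>
      measure (completion (P z)) {\<omega> \<in> space (P z). \<omega> (exit_time z \<omega>) = Some x} =
        c {z, x} / total_conductance E c z"
    and markov: "0 \<le> t \<Longrightarrow> C \<in> sets F \<Longrightarrow>
      AE \<omega> in P z. \<omega> t = Some x \<longrightarrow>
        real_cond_exp (P z) (past F t) (\<lambda>\<omega>. indicat_real C (path_shift t \<omega>)) \<omega> =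
          measure (P x) C"
    and recurrent: "AE \<omega> in P z. \<forall>T\<ge>0. \<exists>t\<ge>T. \<omega> t = Some z"
    and hit_time_exists: "finite A \<Longrightarrow> A \<noteq> {} \<Longrightarrow> AE \<omega> in P z. has_min (hit_times A \<omega>)"
    and hit_law: "finite A \<Longrightarrow> A \<noteq> {} \<Longrightarrow>
      energy_min_ext E c A \<phi> z = (\<integral>\<omega>. \<phi> (the (\<omega> (hit_time A \<omega>))) \<partial>completion (P z))"


section \<open>Green's function\<close>

definition visits :: "'v set \<Rightarrow> 'v \<Rightarrow> 'v path \<Rightarrow> ennreal" where
  "visits A y \<omega> =
     emeasure (count_space UNIV) (components {t \<in> {0..<hit_time A \<omega>}. \<omega> t = Some y})"

definition green :: "('v \<Rightarrow> 'v path measure) \<Rightarrow> 'v set \<Rightarrow> 'v \<Rightarrow> 'v \<Rightarrow> ennreal" where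
  "green P A x y = (\<integral>\<^sup>+\<omega>. visits A y \<omega> \<partial>completion (P x))"

end

theory Submission
  imports Defs
begin

text \<open>
  For \<open>y \<notin> A\<close> let \<open>v\<close> be the energy-minimizing function with \<open>v y = 1\<close> and \<open>v = 0\<close> on \<open>A\<close>, and
  let \<open>C\<close> be its energy. By minimality \<open>g\<^sub>y = v / C\<close> is a reproducing kernel: its inner product in
  the Dirichlet form with a finite-energy function \<open>f\<close> vanishing on \<open>A\<close> is \<open>f y\<close>. Hence
  \<open>g\<^sub>y x = \<langle>g\<^sub>x, g\<^sub>y\<rangle>\<close> is symmetric and nonnegative definite, and it remains to see that
  \<open>G\<^sub>A(x, y) = \<pi>(y) g\<^sub>y(x)\<close>.

  Now \<open>v x\<close> is the probability of hitting \<open>y\<close> before \<open>A\<close>, so the number of visits to \<open>y\<close> is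
  geometric: from \<open>x\<close> at least \<open>m + 1\<close> visits occur with probability \<open>v x \<cdot> r\<^sup>m\<close>, where
  \<open>r = (\<Sum>x\<sim>y. c(y, x) v x / \<pi>(y))\<close> is the probability of returning to \<open>y\<close> before hitting \<open>A\<close>. Thus
  \<open>G\<^sub>A(x, y) = v x / (1 - r)\<close>, and \<open>\<pi>(y) (1 - r) = C\<close> by testing the kernel property against the
  indicator of \<open>y\<close>.
\<close>

section \<open>Dirichlet form and effective conductance\<close>

text \<open>Between two visits the walk may pass through infinity, so there is no discrete chain of
  successive vertices to follow. Whole excursions are handled at once by \<open>hit_law\<close>, and
  the path is cut only at the first hit of \<open>insert y A\<close> and at the exit from
  \<open>y\<close>. Cutting there needs a strong Markov property, whereas the Markov property is
  given at fixed times only. A second obstacle is measurability: \<open>F\<close> need not contain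
  events such as the value of the path at a hitting time, and a number of connected components is
  not visibly measurable. The count is replaced by one that looks at rational times only and agrees
  with it almost surely. Its tail events satisfy two linear relations, one for each cut, and these
  yield the geometric law. Finiteness of the Green function is a by-product: positive energy of the
  voltage makes the return probability smaller than one.\<close>

definition orient :: "'v set \<Rightarrow> 'v \<times> 'v" where
  "orient e = (SOME p. e = {fst p, snd p})"

text \<open>Polarising the energy requires increments that are linear in \<open>f\<close>, which the
  absolute value in \<open>edge_diff\<close> is not. The sign depends on an arbitrary orientation,
  but it cancels in products of two gradients along the same edge.\<close>

definition grad :: "('v \<Rightarrow> real) \<Rightarrow> 'v set \<Rightarrow> real" where
  "grad f e = f (snd (orient e)) - f (fst (orient e))"

lemma orient_doubleton: "orient {x, y} = (x, y) \<or> orient {x, y} = (y, x)"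
proof -
  have "{x, y} = {fst (orient {x, y}), snd (orient {x, y})}"
    unfolding orient_def by (rule someI[of _ "(x, y)"]) simp
  then show ?thesis
    by (auto simp: doubleton_eq_iff prod_eq_iff)
qed

lemma grad_mult_doubleton: "grad f {x, y} * grad g {x, y} = (f y - f x) * (g y - g x)"
  using orient_doubleton[of x y] by (auto simp: grad_def algebra_simps)

lemma grad_linear [simp]:
  "grad (\<lambda>x. f x + g x) e = grad f e + grad g e"
  "grad (\<lambda>x. f x - g x) e = grad f e - grad g e"
  "grad (\<lambda>x. k * f x) e = k * grad f e"
  "grad (\<lambda>x. k) e = 0"
  by (simp_all add: grad_def algebra_simps)

section \<open>The Dirichlet form on functions of finite energy\<close>

locale network = conductance_graph E c
  for E :: "'v set set" and c :: "'v set \<Rightarrow> real" +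
  assumes infinite_vertices: "infinite (UNIV :: 'v set)"
    and connected: "connected_graph E"
    and finite_conductance: "finite_conductance_at E c x"
begin

abbreviation \<pi> :: "'v \<Rightarrow> real" where
  "\<pi> \<equiv> total_conductance E c"

definition finite_energy :: "('v \<Rightarrow> real) \<Rightarrow> bool" where
  "finite_energy f \<longleftrightarrow> (\<lambda>e. c e * (grad f e * grad f e)) summable_on E"

text \<open>A real \<open>infsum\<close> is 0 when the family is not summable, so this value stands
  for the energy only under \<open>finite_energy\<close>; additivity below carries that
  assumption.\<close>

definition dirichlet :: "('v \<Rightarrow> real) \<Rightarrow> ('v \<Rightarrow> real) \<Rightarrow> real" where
  "dirichlet f g = (\<Sum>\<^sub>\<infinity>e\<in>E. c e * (grad f e * grad g e))"

lemma edge_diff_sq: "e \<in> E \<Longrightarrow> (edge_diff f e)\<^sup>2 = grad f e * grad f e"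
  using edges[of e] by (auto simp: grad_mult_doubleton power2_eq_square)

lemma conductance_nonneg: "e \<in> E \<Longrightarrow> 0 \<le> c e"
  using conductance_pos[of e] by simp

lemma energy_term_nonneg: "e \<in> E \<Longrightarrow> 0 \<le> c e * (grad f e * grad f e)"
  using conductance_nonneg[of e] by simp

lemma sum_ennreal_energy:
  assumes "S \<subseteq> E"
  shows "(\<Sum>e\<in>S. ennreal (c e * (edge_diff f e)\<^sup>2)) = ennreal (\<Sum>e\<in>S. c e * (grad f e * grad f e))"
proof -
  have "(\<Sum>e\<in>S. ennreal (c e * (edge_diff f e)\<^sup>2)) = (\<Sum>e\<in>S. ennreal (c e * (grad f e * grad f e)))"
    using assms edge_diff_sq by (intro sum.cong) auto
  also have "\<dots> = ennreal (\<Sum>e\<in>S. c e * (grad f e * grad f e))"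
    using assms energy_term_nonneg by (intro sum_ennreal) blast
  finally show ?thesis .
qed

text \<open>Finite partial sums are the common ground between the \<open>ennreal\<close> energy,
  which may be infinite, and the real form \<open>dirichlet\<close>.\<close>

lemma energy_eq_SUP:
  "energy E c f = (SUP S\<in>{S. finite S \<and> S \<subseteq> E}. ennreal (\<Sum>e\<in>S. c e * (grad f e * grad f e)))"
proof -
  have "energy E c f = (SUP S\<in>{S. finite S \<and> S \<subseteq> E}. \<Sum>e\<in>S. ennreal (c e * (edge_diff f e)\<^sup>2))"
    unfolding energy_def by (rule nonneg_infsum_complete) simp
  also have "\<dots> = (SUP S\<in>{S. finite S \<and> S \<subseteq> E}. ennreal (\<Sum>e\<in>S. c e * (grad f e * grad f e)))"
    by (intro SUP_cong refl sum_ennreal_energy) blast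
  finally show ?thesis .
qed

lemma energy_finite: "finite_energy f \<Longrightarrow> energy E c f = ennreal (dirichlet f f)"
  unfolding energy_eq_SUP dirichlet_def
  by (subst infsum_nonneg_is_SUPREMUM_ennreal)
     (auto simp: finite_energy_def energy_term_nonneg)

lemma finite_energyI:
  assumes "energy E c f \<le> ennreal K"
  shows "finite_energy f"
  unfolding finite_energy_def
proof (rule nonneg_bdd_above_summable_on)
  show "bdd_above (sum (\<lambda>e. c e * (grad f e * grad f e)) ` {F. F \<subseteq> E \<and> finite F})"
  proof (rule bdd_aboveI2)
    fix S assume "S \<in> {F. F \<subseteq> E \<and> finite F}"
    then have "ennreal (\<Sum>e\<in>S. c e * (grad f e * grad f e)) \<le> energy E c f"
      unfolding energy_eq_SUP by (intro SUP_upper) auto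
    \<comment> \<open>\<open>ennreal\<close> sends a negative \<open>K\<close> to 0, hence the real
      bound is \<open>max K 0\<close>.\<close>
    also have "\<dots> \<le> ennreal (max K 0)"
      using assms by (rule order_trans) (simp add: ennreal_leI)
    finally show "(\<Sum>e\<in>S. c e * (grad f e * grad f e)) \<le> max K 0"
      by (subst (asm) ennreal_le_iff) simp_all
  qed
qed (simp add: energy_term_nonneg)

text \<open>Cauchy-Schwarz: after splitting the weight as \<open>sqrt (c e) * sqrt (c e)\<close>,
  each term is a product of members of two square-summable families.\<close>

lemma summable_dirichlet:
  assumes "finite_energy f" "finite_energy g"
  shows "(\<lambda>e. c e * (grad f e * grad g e)) summable_on E"
proof -
  define r where "r f e = sqrt (c e) * grad f e" for f e
  have r: "r f e * r g e = c e * (grad f e * grad g e)" if "e \<in> E" for f g e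
    using conductance_nonneg[OF that] by (simp add: r_def)
  have sq: "(\<lambda>e. norm (r f e * r f e)) summable_on E" if "finite_energy f" for f
    using that unfolding finite_energy_def summable_on_iff_abs_summable_on_real[symmetric]
    by (rule summable_on_cong[THEN iffD2, rotated]) (rule r)
  have "(\<lambda>e. norm (r f e * r g e)) summable_on E"
    by (rule abs_summable_product[OF sq[OF assms(1)] sq[OF assms(2)]])
  then show ?thesis
    unfolding summable_on_iff_abs_summable_on_real[symmetric]
    by (rule summable_on_cong[THEN iffD1, rotated]) (rule r)
qed

lemma dirichlet_commute: "dirichlet f g = dirichlet g f"
  by (simp add: dirichlet_def mult.commute)

lemma dirichlet_nonneg: "0 \<le> dirichlet f f"
  unfolding dirichlet_def by (intro infsum_nonneg energy_term_nonneg)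

lemma finite_energy_scale: "finite_energy f \<Longrightarrow> finite_energy (\<lambda>x. k * f x)"
  unfolding finite_energy_def
  using summable_on_cmult_right[of "\<lambda>e. c e * (grad f e * grad f e)" E "k * k"]
  by (simp add: mult_ac)

lemma finite_energy_add:
  assumes "finite_energy f" "finite_energy g"
  shows "finite_energy (\<lambda>x. f x + g x)"
proof -
  have "(\<lambda>e. c e * (grad f e * grad f e) + c e * (grad f e * grad g e)
      + (c e * (grad g e * grad f e) + c e * (grad g e * grad g e))) summable_on E"
    by (intro summable_on_add summable_dirichlet assms)
  then show ?thesis
    by (simp add: finite_energy_def algebra_simps)
qed

lemma finite_energy_diff:
  assumes "finite_energy f" "finite_energy g"
  shows "finite_energy (\<lambda>x. f x - g x)"
  using finite_energy_add[OF assms(1) finite_energy_scale[OF assms(2), of "-1"]] by simp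

lemma finite_energy_zero: "finite_energy (\<lambda>x. 0)"
  by (simp add: finite_energy_def)

lemma finite_energy_sum:
  "(\<And>i. i \<in> S \<Longrightarrow> finite_energy (F i)) \<Longrightarrow> finite_energy (\<lambda>x. \<Sum>i\<in>S. F i x)"
  by (induction S rule: infinite_finite_induct)
     (auto simp: finite_energy_zero finite_energy_add)

lemma dirichlet_add:
  assumes "finite_energy f" "finite_energy g" "finite_energy h"
  shows "dirichlet (\<lambda>x. f x + g x) h = dirichlet f h + dirichlet g h"
proof -
  have "dirichlet (\<lambda>x. f x + g x) h =
      (\<Sum>\<^sub>\<infinity>e\<in>E. c e * (grad f e * grad h e) + c e * (grad g e * grad h e))"
    by (simp add: dirichlet_def algebra_simps)
  also have "\<dots> = dirichlet f h + dirichlet g h"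
    unfolding dirichlet_def using assms by (intro infsum_add summable_dirichlet)
  finally show ?thesis .
qed

lemma dirichlet_scale: "dirichlet (\<lambda>x. k * f x) g = k * dirichlet f g"
  unfolding dirichlet_def
  by (subst infsum_cmult_right'[symmetric]) (simp add: mult_ac)

lemma dirichlet_diff:
  assumes "finite_energy f" "finite_energy g" "finite_energy h"
  shows "dirichlet (\<lambda>x. f x - g x) h = dirichlet f h - dirichlet g h"
  using dirichlet_add[OF assms(1) finite_energy_scale[OF assms(2), of "-1"] assms(3)]
  by (simp add: dirichlet_scale[of "-1", simplified])

lemma dirichlet_add_right:
  "finite_energy f \<Longrightarrow> finite_energy g \<Longrightarrow> finite_energy h \<Longrightarrow>
    dirichlet h (\<lambda>x. f x + g x) = dirichlet h f + dirichlet h g"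
  by (simp add: dirichlet_add dirichlet_commute[of h])

lemma dirichlet_scale_right: "dirichlet g (\<lambda>x. k * f x) = k * dirichlet g f"
  by (simp add: dirichlet_scale dirichlet_commute[of g])

lemma dirichlet_diff_right:
  "finite_energy f \<Longrightarrow> finite_energy g \<Longrightarrow> finite_energy h \<Longrightarrow>
    dirichlet h (\<lambda>x. f x - g x) = dirichlet h f - dirichlet h g"
  by (simp add: dirichlet_diff dirichlet_commute[of h])

lemma dirichlet_sum:
  assumes "\<And>i. i \<in> S \<Longrightarrow> finite_energy (F i)" "finite_energy h"
  shows "dirichlet (\<lambda>x. \<Sum>i\<in>S. F i x) h = (\<Sum>i\<in>S. dirichlet (F i) h)"
  using assms(1)
proof (induction S rule: infinite_finite_induct)
  case (insert i S)
  then show ?case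
    by (simp add: dirichlet_add finite_energy_sum assms)
qed (simp_all add: dirichlet_def)

section \<open>Pointwise control by the energy\<close>

lemma grad_sq_le_dirichlet:
  assumes "finite_energy f" "e \<in> E"
  shows "c e * (grad f e * grad f e) \<le> dirichlet f f"
  unfolding dirichlet_def
  using finite_sum_le_infsum[of "\<lambda>e. c e * (grad f e * grad f e)" E "{e}"] assms energy_term_nonneg
  by (simp add: finite_energy_def)

text \<open>Along a path from \<open>x\<close> to \<open>y\<close>, each edge \<open>e\<close>
  contributes at most \<open>1 / sqrt (c e)\<close> times the root of the energy. The constant
  depends on the two vertices but not on \<open>f\<close>, so convergence in energy together with
  one fixed value gives pointwise convergence, and zero energy forces a constant.\<close>

lemma diff_le_sqrt_dirichlet:
  "\<exists>K\<ge>0. \<forall>f. finite_energy f \<longrightarrow> \<bar>f y - f x\<bar> \<le> K * sqrt (dirichlet f f)"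
proof -
  have "(adj E)\<^sup>*\<^sup>* x y"
    using connected by (simp add: connected_graph_def)
  then show ?thesis
  proof induction
    case base
    show ?case
      by (intro exI[of _ 0]) simp
  next
    case (step y z)
    then obtain K where K: "0 \<le> K" "\<And>f. finite_energy f \<Longrightarrow> \<bar>f y - f x\<bar> \<le> K * sqrt (dirichlet f f)"
      by blast
    have e: "{y, z} \<in> E"
      using step by (simp add: adj_def)
    have "\<bar>f z - f x\<bar> \<le> (K + 1 / sqrt (c {y, z})) * sqrt (dirichlet f f)" if f: "finite_energy f" for f
    proof -
      have "c {y, z} * (f z - f y)\<^sup>2 \<le> dirichlet f f"
        using grad_sq_le_dirichlet[OF f e] by (simp add: grad_mult_doubleton power2_eq_square)
      then have "sqrt (c {y, z} * (f z - f y)\<^sup>2) \<le> sqrt (dirichlet f f)"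
        by simp
      then have "\<bar>f z - f y\<bar> \<le> 1 / sqrt (c {y, z}) * sqrt (dirichlet f f)"
        using conductance_pos[OF e] by (simp add: real_sqrt_mult field_simps)
      then show ?thesis
        using K(2)[OF f] by (simp add: algebra_simps)
    qed
    then show ?case
      using K(1) conductance_pos[OF e] by (intro exI[of _ "K + 1 / sqrt (c {y, z})"]) auto
  qed
qed

lemma dirichlet_eq_0_imp_const:
  assumes "finite_energy f" "dirichlet f f = 0"
  shows "f x = f y"
  using diff_le_sqrt_dirichlet[of x y] assms by auto

section \<open>Indicators of vertices and the graph Laplacian\<close>

lemma bij_betw_incident_edges:
  "bij_betw (\<lambda>y. {x, y}) {y. adj E x y} {e \<in> E. x \<in> e}"
proof (rule bij_betw_imageI)
  show "inj_on (\<lambda>y. {x, y}) {y. adj E x y}"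
    by (rule inj_onI) (metis doubleton_eq_iff)
  show "(\<lambda>y. {x, y}) ` {y. adj E x y} = {e \<in> E. x \<in> e}"
  proof (rule set_eqI, rule iffI)
    fix e assume e: "e \<in> {e \<in> E. x \<in> e}"
    then obtain a b where "e = {a, b}"
      using edges by blast
    with e obtain y where "e = {x, y}"
      by blast
    with e show "e \<in> (\<lambda>y. {x, y}) ` {y. adj E x y}"
      by (simp add: adj_def)
  qed (auto simp: adj_def)
qed

lemma summable_incident: "c summable_on {e \<in> E. x \<in> e}"
  using finite_conductance[of x] summable_on_reindex_bij_betw[OF bij_betw_incident_edges, of c x]
  by (simp add: finite_conductance_at_def)

lemma grad_eq_0_off_edge:
  assumes "e \<in> E" "x \<notin> e"
  shows "grad (indicat_real {x}) e = 0"
proof -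
  obtain a b where "e = {a, b}"
    using edges[OF assms(1)] by blast
  with assms(2) show ?thesis
    using orient_doubleton[of a b] by (auto simp: grad_def)
qed

lemma grad_indicator_sq:
  assumes "e \<in> E" "x \<in> e"
  shows "grad (indicat_real {x}) e * grad (indicat_real {x}) e = 1"
  using edges[OF assms(1)] assms(2) by (auto simp: grad_mult_doubleton)

text \<open>Each edge at \<open>x\<close> contributes exactly its conductance and every other edge
  nothing, so finiteness of the total conductance at \<open>x\<close> is what is needed
  here.\<close>

lemma finite_energy_indicator: "finite_energy (indicat_real {x})"
proof -
  have "(\<lambda>e. c e * (grad (indicat_real {x}) e * grad (indicat_real {x}) e)) summable_on {e \<in> E. x \<in> e}"
    by (rule summable_on_cong[THEN iffD1, OF _ summable_incident]) (simp add: grad_indicator_sq)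
  then show ?thesis
    unfolding finite_energy_def
    by (rule summable_on_cong_neutral[THEN iffD1, rotated -1]) (auto simp: grad_eq_0_off_edge)
qed

lemma not_adj_self: "\<not> adj E x x"
  using edges[of "{x, x}"] by (auto simp: adj_def)

text \<open>The right-hand side is the unnormalised Laplacian of \<open>f\<close> at
  \<open>x\<close>. This links the Dirichlet form to sums over neighbours, and so to the jump
  probabilities of the walk.\<close>

lemma dirichlet_indicator:
  "dirichlet f (indicat_real {x}) = (\<Sum>\<^sub>\<infinity>y\<in>{y. adj E x y}. c {x, y} * (f x - f y))"
proof -
  have "dirichlet f (indicat_real {x}) =
      (\<Sum>\<^sub>\<infinity>e\<in>{e \<in> E. x \<in> e}. c e * (grad f e * grad (indicat_real {x}) e))"
    unfolding dirichlet_def by (rule infsum_cong_neutral) (auto simp: grad_eq_0_off_edge)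
  also have "\<dots> = (\<Sum>\<^sub>\<infinity>y\<in>{y. adj E x y}.
      c {x, y} * (grad f {x, y} * grad (indicat_real {x}) {x, y}))"
    by (rule infsum_reindex_bij_betw[OF bij_betw_incident_edges, symmetric])
  also have "\<dots> = (\<Sum>\<^sub>\<infinity>y\<in>{y. adj E x y}. c {x, y} * (f x - f y))"
    using not_adj_self[of x] by (intro infsum_cong) (auto simp: grad_mult_doubleton indicator_def)
  finally show ?thesis .
qed

text \<open>An infinite vertex set contains a second vertex, and the first step of a connecting path
  is an edge at \<open>x\<close>.\<close>

lemma total_conductance_pos: "0 < \<pi> x"
proof -
  obtain y where "y \<noteq> x"
    using infinite_vertices by (metis UNIV_eq_I finite.emptyI finite_insert singletonI)
  moreover have "(adj E)\<^sup>*\<^sup>* x y"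
    using connected by (simp add: connected_graph_def)
  ultimately obtain z where z: "adj E x z"
    by (metis converse_rtranclpE)
  have nn: "0 \<le> c {x, y}" if "adj E x y" for y
    using that conductance_nonneg by (simp add: adj_def)
  have "c {x, z} \<le> \<pi> x"
    unfolding total_conductance_def
    using finite_sum_le_infsum[of "\<lambda>y. c {x, y}" "{y. adj E x y}" "{z}"] z nn
      finite_conductance[of x] by (simp add: finite_conductance_at_def)
  moreover have "0 < c {x, z}"
    using z conductance_pos by (simp add: adj_def)
  ultimately show ?thesis
    by simp
qed

lemma finite_energy_finite_support:
  assumes "finite S" "\<And>x. x \<notin> S \<Longrightarrow> f x = 0"
  shows "finite_energy f"
proof -
  have "f = (\<lambda>x. \<Sum>s\<in>S. f s * indicat_real {s} x)"
  proof
    fix x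
    have "(\<Sum>s\<in>S. f s * indicat_real {s} x) = (\<Sum>s\<in>S. if s = x then f s else 0)"
      by (intro sum.cong) (auto simp: indicator_def)
    also have "\<dots> = f x"
      using assms by (simp add: sum.delta)
    finally show "f x = (\<Sum>s\<in>S. f s * indicat_real {s} x)" ..
  qed
  moreover have "finite_energy (\<lambda>x. \<Sum>s\<in>S. f s * indicat_real {s} x)"
    by (intro finite_energy_sum finite_energy_scale finite_energy_indicator)
  ultimately show ?thesis
    by simp
qed

section \<open>Existence, uniqueness and first variation of the energy minimizer\<close>

lemma parallelogram:
  assumes f: "finite_energy f" and g: "finite_energy g"
  shows "dirichlet (\<lambda>x. f x - g x) (\<lambda>x. f x - g x)
    = 2 * dirichlet f f + 2 * dirichlet g g
      - 4 * dirichlet (\<lambda>x. 1/2 * (f x + g x)) (\<lambda>x. 1/2 * (f x + g x))"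
proof -
  note fin = f g finite_energy_add[OF f g] finite_energy_diff[OF f g]
  have "dirichlet (\<lambda>x. f x - g x) (\<lambda>x. f x - g x) = dirichlet f f - 2 * dirichlet f g + dirichlet g g"
    using fin by (simp add: dirichlet_diff dirichlet_diff_right dirichlet_commute[of g f])
  moreover have "dirichlet (\<lambda>x. f x + g x) (\<lambda>x. f x + g x) = dirichlet f f + 2 * dirichlet f g + dirichlet g g"
    using fin by (simp add: dirichlet_add dirichlet_add_right dirichlet_commute[of g f])
  moreover have "dirichlet (\<lambda>x. 1/2 * (f x + g x)) (\<lambda>x. 1/2 * (f x + g x)) =
      1/4 * dirichlet (\<lambda>x. f x + g x) (\<lambda>x. f x + g x)"
    by (simp only: dirichlet_scale dirichlet_scale_right)
  ultimately show ?thesis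
    by simp
qed

text \<open>Finite energy is part of the definition because \<open>dirichlet f f\<close> takes the
  default value 0 for a function of infinite energy, which would be a spurious minimum.\<close>

definition competitors :: "'v set \<Rightarrow> ('v \<Rightarrow> real) \<Rightarrow> ('v \<Rightarrow> real) set" where
  "competitors A \<phi> = {f. finite_energy f \<and> (\<forall>a\<in>A. f a = \<phi> a)}"

lemma midpoint_competitor:
  "f \<in> competitors A \<phi> \<Longrightarrow> g \<in> competitors A \<phi> \<Longrightarrow> (\<lambda>x. 1/2 * (f x + g x)) \<in> competitors A \<phi>"
  using finite_energy_scale[OF finite_energy_add[of f g], of "1/2"] by (simp add: competitors_def)

text \<open>The direct method: midpoints of competitors are competitors, so the parallelogram
  identity makes a minimizing sequence Cauchy in energy. Its members agree at a point of
  \<open>A\<close>, so it converges pointwise, and the energy is lower semicontinuous under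
  pointwise limits. Finiteness of \<open>A\<close> makes the extension of \<open>\<phi>\<close> by
  zero a competitor.\<close>

lemma minimizer_exists:
  assumes A: "finite A" "A \<noteq> {}"
  shows "\<exists>h\<in>competitors A \<phi>. \<forall>f\<in>competitors A \<phi>. dirichlet h h \<le> dirichlet f f"
proof -
  let ?E = "\<lambda>f. dirichlet f f"
  define I where "I = Inf (?E ` competitors A \<phi>)"
  have "(\<lambda>x. if x \<in> A then \<phi> x else 0) \<in> competitors A \<phi>"
    unfolding competitors_def using finite_energy_finite_support[OF A(1)] by simp
  then have ne: "competitors A \<phi> \<noteq> {}"
    by blast
  have bdd: "bdd_below (?E ` competitors A \<phi>)"
    using dirichlet_nonneg by (intro bdd_belowI2[of _ 0])
  have I_le: "I \<le> ?E f" if "f \<in> competitors A \<phi>" for f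
    unfolding I_def using that bdd by (intro cINF_lower)
  have "\<exists>f\<in>competitors A \<phi>. ?E f < I + 1 / Suc n" for n
    using cInf_lessD[of "?E ` competitors A \<phi>" "I + 1 / Suc n"] ne by (auto simp: I_def)
  then obtain F where F: "\<And>n. F n \<in> competitors A \<phi>" "\<And>n. ?E (F n) < I + 1 / Suc n"
    by metis
  have F_fin: "finite_energy (F n)" and F_A: "a \<in> A \<Longrightarrow> F n a = \<phi> a" for n a
    using F(1) by (auto simp: competitors_def)
  \<comment> \<open>Both energies are at most \<open>I + 1 / Suc N\<close> and the midpoint has
    energy at least \<open>I\<close>; in the parallelogram identity the multiples of
    \<open>I\<close> cancel and four error terms remain.\<close>
  have F_diff: "?E (\<lambda>x. F n x - F m x) \<le> 4 / Suc N" if "n \<ge> N" "m \<ge> N" for n m N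
  proof -
    have "1 / real (Suc n) \<le> 1 / Suc N" "1 / real (Suc m) \<le> 1 / Suc N"
      using that by (auto intro!: divide_left_mono)
    then show ?thesis
      using parallelogram[OF F_fin[of n] F_fin[of m]] F(2)[of n] F(2)[of m]
        I_le[OF midpoint_competitor[OF F(1)[of n] F(1)[of m]]] by linarith
  qed
  obtain a where a: "a \<in> A"
    using A by blast
  have "Cauchy (\<lambda>n. F n x)" for x
  proof (rule metric_CauchyI)
    fix \<epsilon> :: real assume \<epsilon>: "0 < \<epsilon>"
    obtain K where K: "0 \<le> K" "\<And>f. finite_energy f \<Longrightarrow> \<bar>f x - f a\<bar> \<le> K * sqrt (?E f)"
      using diff_le_sqrt_dirichlet by metis
    have "(\<lambda>N. K * sqrt (4 / real (Suc N))) \<longlonglongrightarrow> K * sqrt 0"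
      by (intro tendsto_intros LIMSEQ_Suc[OF lim_const_over_n])
    then have "\<forall>\<^sub>F N in sequentially. K * sqrt (4 / real (Suc N)) < \<epsilon>"
      using \<epsilon> by (intro order_tendstoD(2)) simp_all
    then obtain N where N: "K * sqrt (4 / real (Suc N)) < \<epsilon>"
      by (meson eventually_happens sequentially_bot)
    have "dist (F m x) (F n x) < \<epsilon>" if "m \<ge> N" "n \<ge> N" for m n
    proof -
      have "\<bar>(F m x - F n x) - (F m a - F n a)\<bar> \<le> K * sqrt (?E (\<lambda>x. F m x - F n x))"
        using K(2)[OF finite_energy_diff[OF F_fin F_fin]] .
      also have "\<dots> \<le> K * sqrt (4 / real (Suc N))"
        using F_diff[OF that] K(1) by (intro mult_left_mono) auto
      finally show ?thesis
        using N F_A[OF a] by (simp add: dist_real_def)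
    qed
    then show "\<exists>M. \<forall>m\<ge>M. \<forall>n\<ge>M. dist (F m x) (F n x) < \<epsilon>"
      by blast
  qed
  then have "\<exists>l. (\<lambda>n. F n x) \<longlonglongrightarrow> l" for x
    using Cauchy_convergent convergent_def by blast
  then obtain h where h: "\<And>x. (\<lambda>n. F n x) \<longlonglongrightarrow> h x"
    by metis
  have h_A: "h a = \<phi> a" if "a \<in> A" for a
    using LIMSEQ_unique[OF h[of a]] F_A[OF that] by simp
  \<comment> \<open>Lower semicontinuity is read off finite sets of edges, where the limit may be
    taken term by term.\<close>
  have sum_le: "(\<Sum>e\<in>S. c e * (grad h e * grad h e)) \<le> I" if S: "finite S" "S \<subseteq> E" for S
  proof (rule LIMSEQ_le)
    show "(\<lambda>n. \<Sum>e\<in>S. c e * (grad (F n) e * grad (F n) e)) \<longlonglongrightarrow> (\<Sum>e\<in>S. c e * (grad h e * grad h e))"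
      unfolding grad_def by (intro tendsto_intros h)
    have "(\<lambda>n. I + 1 / real (Suc n)) \<longlonglongrightarrow> I + 0"
      by (intro tendsto_intros LIMSEQ_Suc[OF lim_const_over_n])
    then show "(\<lambda>n. I + 1 / real (Suc n)) \<longlonglongrightarrow> I"
      by simp
    have "(\<Sum>e\<in>S. c e * (grad (F n) e * grad (F n) e)) \<le> I + 1 / real (Suc n)" for n
      using finite_sum_le_infsum[of "\<lambda>e. c e * (grad (F n) e * grad (F n) e)" E S] S F_fin[of n]
        F(2)[of n] energy_term_nonneg
      by (auto simp: finite_energy_def dirichlet_def)
    then show "\<exists>N. \<forall>n\<ge>N. (\<Sum>e\<in>S. c e * (grad (F n) e * grad (F n) e)) \<le> I + 1 / real (Suc n)"
      by blast
  qed
  have h_le: "energy E c h \<le> ennreal I"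
    unfolding energy_eq_SUP by (intro SUP_least ennreal_leI sum_le) auto
  have h_fin: "finite_energy h"
    using h_le by (rule finite_energyI)
  have "0 \<le> I"
    unfolding I_def using ne dirichlet_nonneg by (intro cINF_greatest)
  then have "?E h \<le> I"
    using h_le by (simp add: energy_finite[OF h_fin])
  then show ?thesis
    using h_fin h_A I_le by (intro bexI[of _ h]) (auto simp: competitors_def intro: order_trans)
qed

text \<open>The midpoint of two minimizers has no smaller energy, so their difference has zero
  energy; it is constant, and it vanishes on \<open>A\<close>.\<close>

lemma minimizer_unique:
  assumes A: "A \<noteq> {}"
    and h: "h \<in> competitors A \<phi>" "\<And>f. f \<in> competitors A \<phi> \<Longrightarrow> dirichlet h h \<le> dirichlet f f"
    and k: "k \<in> competitors A \<phi>" "\<And>f. f \<in> competitors A \<phi> \<Longrightarrow> dirichlet k k \<le> dirichlet f f"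
  shows "h = k"
proof
  fix x
  have fin: "finite_energy h" "finite_energy k" and eq: "\<And>a. a \<in> A \<Longrightarrow> h a = k a"
    using h(1) k(1) by (auto simp: competitors_def)
  have "dirichlet (\<lambda>x. h x - k x) (\<lambda>x. h x - k x) \<le> 0"
    using parallelogram[OF fin] h(2)[OF midpoint_competitor[OF h(1) k(1)]]
      k(2)[OF midpoint_competitor[OF h(1) k(1)]] by linarith
  then have 0: "dirichlet (\<lambda>x. h x - k x) (\<lambda>x. h x - k x) = 0"
    using dirichlet_nonneg[of "\<lambda>x. h x - k x"] by linarith
  obtain a where a: "a \<in> A"
    using A by blast
  show "h x = k x"
    using dirichlet_eq_0_imp_const[OF finite_energy_diff[OF fin] 0, of x a] eq[OF a] by simp
qed

text \<open>This discharges the \<open>THE\<close> in the definition. A minimizer among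
  finite-energy competitors also beats functions of infinite energy; conversely, any minimizer of
  the \<open>ennreal\<close> energy is bounded by it and so has finite energy itself.\<close>

lemma energy_min_ext_minimizer:
  fixes \<phi> :: "'v \<Rightarrow> real"
  assumes A: "finite A" "A \<noteq> {}"
  defines "h \<equiv> energy_min_ext E c A \<phi>"
  shows "h \<in> competitors A \<phi>" and "f \<in> competitors A \<phi> \<Longrightarrow> dirichlet h h \<le> dirichlet f f"
proof -
  obtain k where k: "k \<in> competitors A \<phi>"
    and k_min: "\<And>f. f \<in> competitors A \<phi> \<Longrightarrow> dirichlet k k \<le> dirichlet f f"
    using minimizer_exists[OF A] by blast
  have k_fin: "finite_energy k" and k_A: "\<forall>a\<in>A. k a = \<phi> a"
    using k by (auto simp: competitors_def)
  have "h = k"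
    unfolding h_def energy_min_ext_def
  proof (rule the_equality, intro conjI allI impI)
    fix f assume f: "\<forall>a\<in>A. f a = \<phi> a"
    show "energy E c k \<le> energy E c f"
    proof (cases "finite_energy f")
      case True
      then have "dirichlet k k \<le> dirichlet f f"
        using f by (intro k_min) (simp add: competitors_def)
      then show ?thesis
        using True by (simp add: energy_finite k_fin ennreal_leI)
    next
      case False
      then have "energy E c f = \<infinity>"
        using finite_energyI by (metis ennreal_enn2real_if infinity_ennreal_def order_refl)
      then show ?thesis
        by simp
    qed
  next
    fix g assume g: "(\<forall>a\<in>A. g a = \<phi> a) \<and>
      (\<forall>f. (\<forall>a\<in>A. f a = \<phi> a) \<longrightarrow> energy E c g \<le> energy E c f)"
    then have "energy E c g \<le> ennreal (dirichlet k k)"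
      using k_A energy_finite[OF k_fin] by metis
    moreover from this have g_fin: "finite_energy g"
      by (rule finite_energyI)
    ultimately have "dirichlet g g \<le> dirichlet k k"
      by (simp add: energy_finite dirichlet_nonneg)
    with k_min have "dirichlet g g \<le> dirichlet f f" if "f \<in> competitors A \<phi>" for f
      using that order_trans by blast
    with g g_fin k k_min show "g = k"
      by (intro minimizer_unique[OF A(2)]) (auto simp: competitors_def)
  qed (use k_A in blast)
  with k k_min show "h \<in> competitors A \<phi>" and "f \<in> competitors A \<phi> \<Longrightarrow> dirichlet h h \<le> dirichlet f f"
    by auto
qed

text \<open>The Euler-Lagrange equation: \<open>h + t * k\<close> has the same boundary values as
  \<open>h\<close>, so a quadratic polynomial in \<open>t\<close> without constant term is
  nonnegative everywhere, which forces its linear coefficient to vanish.\<close>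

lemma energy_min_ext_orthogonal:
  assumes A: "finite A" "A \<noteq> {}" and k: "finite_energy k" "\<And>a. a \<in> A \<Longrightarrow> k a = 0"
  shows "dirichlet (energy_min_ext E c A \<phi>) k = 0"
proof -
  define h where "h = energy_min_ext E c A \<phi>"
  have h: "h \<in> competitors A \<phi>" and h_min: "\<And>f. f \<in> competitors A \<phi> \<Longrightarrow> dirichlet h h \<le> dirichlet f f"
    unfolding h_def using energy_min_ext_minimizer[OF A] by blast+
  have h_fin: "finite_energy h"
    using h by (simp add: competitors_def)
  have ineq: "0 \<le> 2 * t * dirichlet h k + t * t * dirichlet k k" for t
  proof -
    have tk: "finite_energy (\<lambda>x. t * k x)"
      using k(1) by (rule finite_energy_scale)
    note htk = finite_energy_add[OF h_fin tk]
    have "dirichlet h h \<le> dirichlet (\<lambda>x. h x + t * k x) (\<lambda>x. h x + t * k x)"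
      using h k htk by (intro h_min) (auto simp: competitors_def)
    also have "\<dots> = dirichlet h h + 2 * t * dirichlet h k + t * t * dirichlet k k"
      using h_fin k(1) tk htk
      by (simp add: dirichlet_add dirichlet_add_right dirichlet_scale dirichlet_scale_right
          dirichlet_commute[of k h] algebra_simps)
    finally show ?thesis
      by simp
  qed
  show ?thesis
    unfolding h_def[symmetric]
  proof (cases "dirichlet k k = 0")
    case True
    then show "dirichlet h k = 0"
      using ineq[of 1] ineq[of "-1"] by simp
  next
    case False
    then have pos: "0 < dirichlet k k"
      using dirichlet_nonneg[of k] by simp
    \<comment> \<open>The chosen \<open>t\<close> is the minimum point of the quadratic
      polynomial.\<close>
    have "0 \<le> - (dirichlet h k * dirichlet h k) / dirichlet k k"
      using ineq[of "- dirichlet h k / dirichlet k k"] pos by (simp add: field_simps)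
    then have "dirichlet h k * dirichlet h k \<le> 0"
      using pos by (simp add: divide_le_0_iff)
    then show "dirichlet h k = 0"
      by (auto simp: mult_le_0_iff)
  qed
qed

text \<open>The energy of a unit voltage between \<open>y\<close> and \<open>A\<close> is the effective conductance; dividing the
  voltage by it gives the reproducing kernel of the Dirichlet form on functions vanishing on \<open>A\<close>.\<close>

definition voltage :: "'v set \<Rightarrow> 'v \<Rightarrow> 'v \<Rightarrow> real" where
  "voltage A y = energy_min_ext E c (insert y A) (indicat_real {y})"

definition eff_conductance :: "'v set \<Rightarrow> 'v \<Rightarrow> real" where
  "eff_conductance A y = dirichlet (voltage A y) (voltage A y)"

lemma voltage:
  assumes "finite A" "y \<notin> A"
  shows finite_energy_voltage: "finite_energy (voltage A y)"
    and voltage_source: "voltage A y y = 1"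
    and voltage_sink: "a \<in> A \<Longrightarrow> voltage A y a = 0"
  using energy_min_ext_minimizer(1)[of "insert y A" "indicat_real {y}"] assms
  by (auto simp: voltage_def competitors_def indicator_def)

text \<open>Subtracting \<open>f y\<close> times the voltage makes \<open>f\<close> vanish at
  \<open>y\<close> as well as on \<open>A\<close>, so the remainder is an admissible variation and
  is orthogonal to the voltage.\<close>

lemma dirichlet_voltage:
  assumes A: "finite A" "y \<notin> A" and f: "finite_energy f" "\<And>a. a \<in> A \<Longrightarrow> f a = 0"
  shows "dirichlet (voltage A y) f = f y * eff_conductance A y"
proof -
  note fv = finite_energy_voltage[OF A]
  have "dirichlet (voltage A y) (\<lambda>x. f x - f y * voltage A y x) = 0"
    unfolding voltage_def
    by (rule energy_min_ext_orthogonal, fold voltage_def)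
       (use A f voltage[OF A] in \<open>auto intro!: finite_energy_diff finite_energy_scale\<close>)
  then show ?thesis
    using f(1) finite_energy_scale[OF fv, of "f y"] fv
    by (simp add: dirichlet_diff_right dirichlet_scale_right eff_conductance_def)
qed

lemma eff_conductance_pos:
  assumes A: "finite A" "A \<noteq> {}" "y \<notin> A"
  shows "0 < eff_conductance A y"
proof (rule ccontr)
  assume "\<not> 0 < eff_conductance A y"
  then have 0: "dirichlet (voltage A y) (voltage A y) = 0"
    using dirichlet_nonneg[of "voltage A y"] by (simp add: eff_conductance_def)
  obtain a where "a \<in> A"
    using A by blast
  then show False
    using dirichlet_eq_0_imp_const[OF finite_energy_voltage 0, of y a] voltage[of A y] A by auto
qed

text \<open>The net current leaving \<open>y\<close> equals the energy of the unit voltage;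
  multiplied out with the jump probabilities, this sum will become an escape probability.\<close>

lemma eff_conductance_eq:
  assumes A: "finite A" "y \<notin> A"
  shows "(\<Sum>\<^sub>\<infinity>x\<in>{x. adj E y x}. c {y, x} * (1 - voltage A y x)) = eff_conductance A y"
proof -
  have "indicat_real {y} a = 0" if "a \<in> A" for a
    using that A by (auto simp: indicator_def)
  then have "dirichlet (voltage A y) (indicat_real {y}) = eff_conductance A y"
    using dirichlet_voltage[OF A finite_energy_indicator[of y]] by simp
  then show ?thesis
    by (simp add: dirichlet_indicator voltage_source[OF A])
qed

text \<open>The pole is the second argument, in the order of \<open>green P A x y\<close>. A pole in
  \<open>A\<close> would contradict the boundary value 0 there, so the kernel is set to 0, in
  agreement with the absence of visits to \<open>A\<close> before it is hit.\<close>

definition kernel :: "'v set \<Rightarrow> 'v \<Rightarrow> 'v \<Rightarrow> real" where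
  "kernel A x y = (if x \<in> A \<or> y \<in> A then 0 else voltage A y x / eff_conductance A y)"

lemma kernel_eq_scaled:
  assumes "y \<notin> A" "finite A"
  shows "(\<lambda>x. kernel A x y) = (\<lambda>x. 1 / eff_conductance A y * voltage A y x)"
  using assms voltage_sink by (auto simp: kernel_def)

lemma finite_energy_kernel:
  assumes "finite A"
  shows "finite_energy (\<lambda>x. kernel A x y)"
proof (cases "y \<in> A")
  case True
  then show ?thesis
    by (simp add: kernel_def finite_energy_zero)
next
  case False
  then show ?thesis
    unfolding kernel_eq_scaled[OF False assms]
    by (intro finite_energy_scale finite_energy_voltage assms)
qed

lemma kernel_reproducing:
  assumes A: "finite A" "A \<noteq> {}" and f: "finite_energy f" "\<And>a. a \<in> A \<Longrightarrow> f a = 0"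
  shows "dirichlet (\<lambda>x. kernel A x y) f = f y"
proof (cases "y \<in> A")
  case True
  then show ?thesis
    using f(2) by (simp add: kernel_def dirichlet_def)
next
  case False
  then show ?thesis
    using eff_conductance_pos[OF A False]
    unfolding kernel_eq_scaled[OF False A(1)] dirichlet_scale
    by (simp add: dirichlet_voltage[OF A(1) False f])
qed

lemma kernel_symmetric:
  assumes A: "finite A" "A \<noteq> {}"
  shows "kernel A x y = kernel A y x"
proof -
  have "kernel A x y = dirichlet (\<lambda>z. kernel A z x) (\<lambda>z. kernel A z y)"
    using kernel_reproducing[OF A finite_energy_kernel[OF A(1)], of y x] by (simp add: kernel_def)
  also have "\<dots> = dirichlet (\<lambda>z. kernel A z y) (\<lambda>z. kernel A z x)"
    by (rule dirichlet_commute)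
  also have "\<dots> = kernel A y x"
    using kernel_reproducing[OF A finite_energy_kernel[OF A(1)], of x y] by (simp add: kernel_def)
  finally show ?thesis .
qed

lemma kernel_nonneg_definite:
  assumes A: "finite A" "A \<noteq> {}"
  shows "0 \<le> (\<Sum>x\<in>S. \<Sum>y\<in>S. f x * f y * kernel A x y)"
proof -
  \<comment> \<open>\<open>u\<close> is the potential of the charge \<open>f\<close> on
    \<open>S\<close>; the quadratic form will be its energy.\<close>
  define u where "u = (\<lambda>x. \<Sum>y\<in>S. f y * kernel A x y)"
  have u: "finite_energy u" "\<And>a. a \<in> A \<Longrightarrow> u a = 0"
    unfolding u_def
    by (intro finite_energy_sum finite_energy_scale finite_energy_kernel A) (simp add: kernel_def)
  have "0 \<le> dirichlet u u"
    by (rule dirichlet_nonneg)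
  also have "dirichlet u u = (\<Sum>y\<in>S. f y * dirichlet (\<lambda>x. kernel A x y) u)"
    by (subst (1) u_def)
       (simp add: dirichlet_sum dirichlet_scale finite_energy_scale finite_energy_kernel A u(1))
  also have "\<dots> = (\<Sum>y\<in>S. f y * u y)"
    using kernel_reproducing[OF A u] by simp
  also have "\<dots> = (\<Sum>x\<in>S. \<Sum>y\<in>S. f x * f y * kernel A x y)"
    by (simp add: u_def sum_distrib_left mult_ac)
  finally show ?thesis .
qed

end

section \<open>Counting visits along a path\<close>

text \<open>Visits to \<open>y\<close> before hitting \<open>A\<close> are counted by the times at which they end.\<close>

definition visit_ends :: "'v set \<Rightarrow> 'v \<Rightarrow> 'v path \<Rightarrow> real set" where
  "visit_ends A y \<omega> = {b. (\<exists>a\<ge>0. a < b \<and> (\<forall>s\<in>{a..<b}. \<omega> s = Some y)) \<and> \<omega> b \<noteq> Some y \<and>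
     (\<forall>s\<in>{0..<b}. \<omega> s \<notin> Some ` A)}"

definition num_visits :: "'v set \<Rightarrow> 'v \<Rightarrow> 'v path \<Rightarrow> ennreal" where
  "num_visits A y \<omega> = emeasure (count_space UNIV) (visit_ends A y \<omega>)"

definition right_constant_path :: "'v path \<Rightarrow> bool" where
  "right_constant_path \<omega> \<longleftrightarrow> (\<forall>t\<ge>0. \<omega> t \<noteq> None \<longrightarrow> (\<exists>\<epsilon>>0. \<forall>s\<in>{t..t+\<epsilon>}. \<omega> s = \<omega> t))"

text \<open>Every visit to \<open>y\<close> ends with a jump to a vertex; this is only required of the visits
  observed at rational times, so that it follows from the Markov property at fixed times.\<close>

definition regular_path :: "'v \<Rightarrow> 'v path \<Rightarrow> bool" where
  "regular_path y \<omega> \<longleftrightarrow> right_constant_path \<omega> \<and>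
     (\<forall>q\<in>\<rat>. 0 \<le> q \<longrightarrow> \<omega> q = Some y \<longrightarrow>
       (\<exists>b>q. \<omega> b \<noteq> Some y \<and> \<omega> b \<noteq> None \<and> (\<forall>s\<in>{q..<b}. \<omega> s = Some y)))"

lemma right_constant_pathD:
  assumes "right_constant_path \<omega>" "0 \<le> t" "\<omega> t \<noteq> None"
  obtains \<epsilon> where "0 < \<epsilon>" "\<And>s. t \<le> s \<Longrightarrow> s \<le> t + \<epsilon> \<Longrightarrow> \<omega> s = \<omega> t"
proof -
  obtain \<epsilon> where "0 < \<epsilon>" "\<forall>s\<in>{t..t+\<epsilon>}. \<omega> s = \<omega> t"
    using assms unfolding right_constant_path_def by blast
  then show ?thesis
    by (meson atLeastAtMost_iff that)
qed

text \<open>A vertex, once reached, is kept for a short while, so events at vertices leave a trace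
  at rational times. At infinity this fails, hence the condition
  \<open>\<omega> t \<noteq> None\<close>.\<close>

lemma rational_just_after:
  assumes "right_constant_path \<omega>" "0 \<le> t" "\<omega> t \<noteq> None" "t < u"
  obtains q where "q \<in> \<rat>" "t < q" "q < u" "\<And>s. t \<le> s \<Longrightarrow> s \<le> q \<Longrightarrow> \<omega> s = \<omega> t"
proof -
  obtain \<epsilon> where \<epsilon>: "0 < \<epsilon>" "\<And>s. t \<le> s \<Longrightarrow> s \<le> t + \<epsilon> \<Longrightarrow> \<omega> s = \<omega> t"
    using right_constant_pathD assms by metis
  obtain q where q: "q \<in> \<rat>" "t < q" "q < min u (t + \<epsilon>)"
    using Rats_dense_in_real[of t "min u (t + \<epsilon>)"] assms(4) \<epsilon>(1) by auto
  show ?thesis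
  proof (rule that[OF q(1,2)])
    show "q < u"
      using q(3) by simp
    show "\<omega> s = \<omega> t" if "t \<le> s" "s \<le> q" for s
      using \<epsilon>(2)[of s] that q(3) by simp
  qed
qed

lemma visit_end_exists:
  assumes reg: "regular_path y \<omega>" and t: "0 \<le> t" "\<omega> t = Some y"
  obtains b where "t < b" "\<omega> b \<noteq> Some y" "\<omega> b \<noteq> None" "\<And>s. t \<le> s \<Longrightarrow> s < b \<Longrightarrow> \<omega> s = Some y"
proof -
  have rc: "right_constant_path \<omega>"
    using reg by (simp add: regular_path_def)
  obtain q where q: "q \<in> \<rat>" "t < q" "\<And>s. t \<le> s \<Longrightarrow> s \<le> q \<Longrightarrow> \<omega> s = \<omega> t"
    by (rule rational_just_after[OF rc t(1), of "t + 1"]) (use t(2) in auto)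
  moreover have "\<omega> q = Some y"
    using q(2) q(3)[of q] t(2) by simp
  ultimately obtain b where b: "q < b" "\<omega> b \<noteq> Some y" "\<omega> b \<noteq> None" "\<forall>s\<in>{q..<b}. \<omega> s = Some y"
    using reg t(1) unfolding regular_path_def by (meson less_imp_le order_trans)
  show ?thesis
  proof (rule that[OF _ b(2,3)])
    show "t < b"
      using q(2) b(1) by simp
    show "\<omega> s = Some y" if "t \<le> s" "s < b" for s
      using q(3)[of s] t(2) b(4) that by (cases "s \<le> q") auto
  qed
qed

lemma path_shift_apply [simp]: "0 \<le> s \<Longrightarrow> path_shift t \<omega> s = \<omega> (s + t)"
  by (simp add: path_shift_def)

lemma right_constant_path_shift:
  assumes "right_constant_path \<omega>" "0 \<le> t"
  shows "right_constant_path (path_shift t \<omega>)"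
  unfolding right_constant_path_def
proof (intro allI impI)
  fix s :: real assume s: "0 \<le> s" "path_shift t \<omega> s \<noteq> None"
  then obtain \<epsilon> where "0 < \<epsilon>" "\<And>r. s + t \<le> r \<Longrightarrow> r \<le> s + t + \<epsilon> \<Longrightarrow> \<omega> r = \<omega> (s + t)"
    using right_constant_pathD[OF assms(1), of "s + t"] assms(2) by auto
  note \<epsilon> = this
  have "path_shift t \<omega> r = path_shift t \<omega> s" if "r \<in> {s..s + \<epsilon>}" for r
    using \<epsilon>(2)[of "r + t"] that s(1) by simp
  with \<epsilon>(1) show "\<exists>\<epsilon>>0. \<forall>r\<in>{s..s + \<epsilon>}. path_shift t \<omega> r = path_shift t \<omega> s"
    by blast
qed

lemma regular_path_shift:
  assumes "regular_path y \<omega>" "t \<in> \<rat>" "0 \<le> t"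
  shows "regular_path y (path_shift t \<omega>)"
  unfolding regular_path_def
proof (intro conjI ballI impI)
  show "right_constant_path (path_shift t \<omega>)"
    using assms by (intro right_constant_path_shift) (auto simp: regular_path_def)
next
  fix q :: real assume q: "q \<in> \<rat>" "0 \<le> q" "path_shift t \<omega> q = Some y"
  then obtain b where "q + t < b" "\<omega> b \<noteq> Some y" "\<omega> b \<noteq> None"
      "\<And>s. q + t \<le> s \<Longrightarrow> s < b \<Longrightarrow> \<omega> s = Some y"
    using visit_end_exists[OF assms(1), of "q + t"] assms(3) by auto
  then show "\<exists>b>q. path_shift t \<omega> b \<noteq> Some y \<and> path_shift t \<omega> b \<noteq> None \<and>
      (\<forall>s\<in>{q..<b}. path_shift t \<omega> s = Some y)"
    using q(2) by (intro exI[of _ "b - t"]) auto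
qed

section \<open>Hitting and exit times, and ends of visits as labels of components\<close>

lemma has_min_Least:
  assumes "has_min S"
  shows "(LEAST t. t \<in> S) \<in> S" and "s \<in> S \<Longrightarrow> (LEAST t. t \<in> S) \<le> s"
proof -
  obtain m where m: "m \<in> S" "\<And>s. s \<in> S \<Longrightarrow> m \<le> s"
    using assms by (auto simp: has_min_def)
  then have "(LEAST t. t \<in> S) = m"
    by (intro Least_equality)
  with m show "(LEAST t. t \<in> S) \<in> S" and "s \<in> S \<Longrightarrow> (LEAST t. t \<in> S) \<le> s"
    by auto
qed

lemma hit_time:
  assumes "has_min (hit_times A \<omega>)"
  shows hit_time_nonneg: "0 \<le> hit_time A \<omega>"
    and at_hit_time: "\<omega> (hit_time A \<omega>) \<in> Some ` A"
    and before_hit_time: "0 \<le> s \<Longrightarrow> s < hit_time A \<omega> \<Longrightarrow> \<omega> s \<notin> Some ` A"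
  using has_min_Least[OF assms] unfolding hit_time_def by (force simp: hit_times_def)+

lemma exit_time:
  assumes "has_min (exit_times z \<omega>)"
  shows exit_time_pos: "0 < exit_time z \<omega>"
    and at_exit_time: "\<omega> (exit_time z \<omega>) \<noteq> Some z"
    and before_exit_time: "0 < s \<Longrightarrow> s < exit_time z \<omega> \<Longrightarrow> \<omega> s = Some z"
  using has_min_Least[OF assms] unfolding exit_time_def by (force simp: exit_times_def)+

text \<open>Equality can occur: the last visit may end with the jump into \<open>A\<close>. This is
  why a visit end \<open>b\<close> requires \<open>A\<close> to be avoided on \<open>{0..<b}\<close>
  only.\<close>

lemma visit_ends_le_hit_time:
  assumes "has_min (hit_times A \<omega>)" "b \<in> visit_ends A y \<omega>"
  shows "b \<le> hit_time A \<omega>"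
  using hit_time_nonneg[OF assms(1)] at_hit_time[OF assms(1)] assms(2)
  by (force simp: visit_ends_def not_le)

text \<open>Each end \<open>b\<close> is sent to the component containing some time
  \<open>a b\<close> of the visit that it ends. Two ends cannot share a component, since the path is
  away from \<open>y\<close> at the earlier one; every component is reached, since on a regular path
  each visit has an end.\<close>

lemma visits_eq_num_visits:
  assumes reg: "regular_path y \<omega>" and hit: "has_min (hit_times A \<omega>)"
  shows "visits A y \<omega> = num_visits A y \<omega>"
proof (cases "y \<in> A")
  case True
  have "{t \<in> {0..<hit_time A \<omega>}. \<omega> t = Some y} = {}"
    using before_hit_time[OF hit] True by force
  then have "visits A y \<omega> = 0"
    unfolding visits_def by (simp only: components_empty emeasure_empty)
  moreover have "visit_ends A y \<omega> = {}"
    using True by (force simp: visit_ends_def)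
  ultimately show ?thesis
    by (simp add: num_visits_def)
next
  case False
  define S where "S = {t \<in> {0..<hit_time A \<omega>}. \<omega> t = Some y}"
  define a where "a b = (SOME a. 0 \<le> a \<and> a < b \<and> (\<forall>s\<in>{a..<b}. \<omega> s = Some y))" for b
  have a: "0 \<le> a b" "a b < b" "\<And>s. a b \<le> s \<Longrightarrow> s < b \<Longrightarrow> \<omega> s = Some y"
    if "b \<in> visit_ends A y \<omega>" for b
  proof -
    have "\<exists>a. 0 \<le> a \<and> a < b \<and> (\<forall>s\<in>{a..<b}. \<omega> s = Some y)"
      using that by (auto simp: visit_ends_def)
    then have "0 \<le> a b \<and> a b < b \<and> (\<forall>s\<in>{a b..<b}. \<omega> s = Some y)"
      unfolding a_def by (rule someI_ex)
    then show "0 \<le> a b" "a b < b" "\<And>s. a b \<le> s \<Longrightarrow> s < b \<Longrightarrow> \<omega> s = Some y"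
      by auto
  qed
  have sub: "{t..<b} \<subseteq> S" if "b \<in> visit_ends A y \<omega>" "0 \<le> t" "\<And>s. t \<le> s \<Longrightarrow> s < b \<Longrightarrow> \<omega> s = Some y" for b t
    using visit_ends_le_hit_time[OF hit that(1)] that by (auto simp: S_def)
  have in_S: "a b \<in> S" if "b \<in> visit_ends A y \<omega>" for b
    using sub[OF that a(1,3)[OF that]] a(2)[OF that] by auto
  have "bij_betw (\<lambda>b. connected_component_set S (a b)) (visit_ends A y \<omega>) (components S)"
  proof (rule bij_betw_imageI)
    show "inj_on (\<lambda>b. connected_component_set S (a b)) (visit_ends A y \<omega>)"
    proof (rule linorder_inj_onI)
      fix b b' assume b: "b < b'" "b \<in> visit_ends A y \<omega>" "b' \<in> visit_ends A y \<omega>"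
      have b_ne: "\<omega> b \<noteq> Some y"
        using b(2) by (simp add: visit_ends_def)
      have lt: "b < a b'"
        using a(3)[OF b(3), of b] b(1) b_ne by force
      show "connected_component_set S (a b) \<noteq> connected_component_set S (a b')"
      proof
        assume eq: "connected_component_set S (a b) = connected_component_set S (a b')"
        have "a b' \<in> connected_component_set S (a b)"
          unfolding eq using in_S[OF b(3)] by simp
        moreover have "a b \<in> connected_component_set S (a b)"
          using in_S[OF b(2)] by simp
        ultimately have "b \<in> connected_component_set S (a b)"
          using connectedD_interval[OF connected_connected_component, of "a b" S "a b" "a b'" b]
            a(2)[OF b(2)] lt by simp
        then have "b \<in> S"
          using connected_component_subset by blast
        then show False
          using b_ne by (simp add: S_def)
      qed
    qed auto
    show "(\<lambda>b. connected_component_set S (a b)) ` visit_ends A y \<omega> = components S"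
    proof (rule set_eqI, rule iffI)
      fix C assume "C \<in> components S"
      then obtain t where t: "t \<in> S" "C = connected_component_set S t"
        by (auto simp: components_iff)
      then have t0: "0 \<le> t" "t < hit_time A \<omega>" "\<omega> t = Some y"
        by (auto simp: S_def)
      obtain b where b: "t < b" "\<omega> b \<noteq> Some y" "\<And>s. t \<le> s \<Longrightarrow> s < b \<Longrightarrow> \<omega> s = Some y"
        using visit_end_exists[OF reg t0(1,3)] by blast
      have "\<omega> s \<notin> Some ` A" if "0 \<le> s" "s < b" for s
        using before_hit_time[OF hit, of s] b(3)[of s] that t0(2) False by (cases "s < t") auto
      with b t0 have end_b: "b \<in> visit_ends A y \<omega>"
        by (auto simp: visit_ends_def)
      \<comment> \<open>Both \<open>t\<close> and \<open>a b\<close> lie in visits that last until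
        \<open>b\<close>, so the interval from the smaller of them to \<open>b\<close> connects them
        within \<open>S\<close>.\<close>
      have "{min t (a b)..<b} \<subseteq> S"
        using sub[OF end_b t0(1) b(3)] sub[OF end_b a(1,3)[OF end_b]] by (auto simp: min_def)
      moreover have "t \<in> {min t (a b)..<b}" "a b \<in> {min t (a b)..<b}"
        using b(1) a(2)[OF end_b] by auto
      ultimately have "connected_component S (a b) t"
        unfolding connected_component_def by (intro exI[of _ "{min t (a b)..<b}"]) simp
      then have "C = connected_component_set S (a b)"
        using t(2) connected_component_eq by fastforce
      with end_b show "C \<in> (\<lambda>b. connected_component_set S (a b)) ` visit_ends A y \<omega>"
        by blast
    qed (auto simp: components_iff intro: in_S)
  qed
  then show ?thesis
    unfolding visits_def num_visits_def S_def[symmetric]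
    by (simp add: emeasure_count_space bij_betw_finite bij_betw_same_card)
qed

section \<open>Visit counts under time shifts\<close>

lemma visit_ends_shift:
  assumes t: "0 \<le> t" "\<And>s. 0 \<le> s \<Longrightarrow> s < t \<Longrightarrow> \<omega> s \<notin> Some ` A"
  shows "visit_ends A y \<omega> \<inter> {t<..} = (\<lambda>b. b + t) ` visit_ends A y (path_shift t \<omega>)"
proof (rule set_eqI, rule iffI)
  fix b assume "b \<in> visit_ends A y \<omega> \<inter> {t<..}"
  then obtain a where a: "0 \<le> a" "a < b" "\<And>s. a \<le> s \<Longrightarrow> s < b \<Longrightarrow> \<omega> s = Some y"
    and b: "t < b" "\<omega> b \<noteq> Some y" "\<And>s. 0 \<le> s \<Longrightarrow> s < b \<Longrightarrow> \<omega> s \<notin> Some ` A"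
    by (auto simp: visit_ends_def)
  have "b - t \<in> visit_ends A y (path_shift t \<omega>)"
    unfolding visit_ends_def
  \<comment> \<open>The visit may already be under way at time \<open>t\<close>; its remaining part
    then begins at time 0 of the shifted path.\<close>
  proof (intro CollectI conjI exI[of _ "max 0 (a - t)"] ballI)
    fix s assume "s \<in> {max 0 (a - t)..<b - t}"
    then show "path_shift t \<omega> s = Some y"
      using a(3)[of "s + t"] by auto
  next
    fix s assume "s \<in> {0..<b - t}"
    then show "path_shift t \<omega> s \<notin> Some ` A"
      using b(3)[of "s + t"] t(1) by auto
  qed (use a b in auto)
  then show "b \<in> (\<lambda>b. b + t) ` visit_ends A y (path_shift t \<omega>)"
    by (rule rev_image_eqI) simp
next
  fix b' assume "b' \<in> (\<lambda>b. b + t) ` visit_ends A y (path_shift t \<omega>)"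
  then obtain b a where b': "b' = b + t"
    and a: "0 \<le> a" "a < b" "\<And>s. a \<le> s \<Longrightarrow> s < b \<Longrightarrow> path_shift t \<omega> s = Some y"
    and b: "path_shift t \<omega> b \<noteq> Some y" "\<And>s. 0 \<le> s \<Longrightarrow> s < b \<Longrightarrow> path_shift t \<omega> s \<notin> Some ` A"
    by (auto simp: visit_ends_def)
  have "\<omega> s = Some y" if "a + t \<le> s" "s < b + t" for s
    using a(1) a(3)[of "s - t"] that by auto
  moreover have "\<omega> s \<notin> Some ` A" if "0 \<le> s" "s < b + t" for s
    using t(2)[of s] b(2)[of "s - t"] that by (cases "s < t") auto
  ultimately show "b' \<in> visit_ends A y \<omega> \<inter> {t<..}"
    using a(1,2) b(1) t(1) unfolding visit_ends_def b'
    by (auto intro!: exI[of _ "a + t"])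
qed

lemma emeasure_count_space_shift:
  "emeasure (count_space UNIV) ((\<lambda>b. b + t) ` B) = emeasure (count_space UNIV) B" for t :: real
  by (simp add: emeasure_count_space finite_image_iff card_image)

text \<open>No visit ends up to time \<open>t\<close>: there is none before \<open>T\<close>, and
  the one begun at \<open>T\<close> is still in progress at \<open>t\<close>. A shift by some
  \<open>t\<close> after \<open>T\<close> is needed because random times will be approximated from
  above.\<close>

lemma num_visits_shift_first_hit:
  assumes T: "0 \<le> T" "T \<le> t" "y \<notin> A"
    and before: "\<And>s. 0 \<le> s \<Longrightarrow> s < T \<Longrightarrow> \<omega> s \<notin> Some ` insert y A"
    and at: "\<And>s. T \<le> s \<Longrightarrow> s \<le> t \<Longrightarrow> \<omega> s = Some y"
  shows "num_visits A y (path_shift t \<omega>) = num_visits A y \<omega>"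
proof -
  have "\<omega> s \<notin> Some ` A" if "0 \<le> s" "s < t" for s
    using before[of s] at[of s] that T(3) by (cases "s < T") auto
  moreover have "t < b" if b: "b \<in> visit_ends A y \<omega>" for b
  proof (rule ccontr)
    assume "\<not> t < b"
    moreover obtain a where "0 \<le> a" "a < b" "\<omega> a = Some y"
      using b by (force simp: visit_ends_def)
    ultimately have "T \<le> b"
      using before[of a] by force
    with \<open>\<not> t < b\<close> show False
      using at[of b] b by (simp add: visit_ends_def)
  qed
  ultimately show ?thesis
    using visit_ends_shift[of t \<omega> A y] T emeasure_count_space_shift[of t "visit_ends A y (path_shift t \<omega>)"]
    by (simp add: num_visits_def Int_absorb2 subset_iff)
qed

lemma num_visits_eq_0:
  assumes T: "0 \<le> T" "\<omega> T \<in> Some ` A" "\<And>s. 0 \<le> s \<Longrightarrow> s < T \<Longrightarrow> \<omega> s \<noteq> Some y"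
  shows "num_visits A y \<omega> = 0"
proof -
  have "b \<notin> visit_ends A y \<omega>" for b
  proof
    assume b: "b \<in> visit_ends A y \<omega>"
    then obtain a where a: "0 \<le> a" "a < b" "\<omega> a = Some y"
      unfolding visit_ends_def by auto
    then have "T < b"
      using T(3)[of a] by force
    then show False
      using b T(1,2) unfolding visit_ends_def by auto
  qed
  then have "visit_ends A y \<omega> = {}"
    by blast
  then show ?thesis
    by (simp add: num_visits_def)
qed

text \<open>Exactly one visit end, namely \<open>T\<close>, lies in \<open>{0..t}\<close>. If the
  exit leads into \<open>A\<close>, the shifted path starts in \<open>A\<close> and has no visits
  left to count.\<close>

lemma num_visits_shift_exit:
  assumes T: "0 < T" "T \<le> t" "y \<notin> A"
    and before: "\<And>s. 0 \<le> s \<Longrightarrow> s < T \<Longrightarrow> \<omega> s = Some y"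
    and at: "\<And>s. T \<le> s \<Longrightarrow> s \<le> t \<Longrightarrow> \<omega> s = \<omega> T" "\<omega> T \<noteq> Some y"
  shows "num_visits A y \<omega> = 1 + num_visits A y (path_shift t \<omega>)"
proof -
  have T_in: "T \<in> visit_ends A y \<omega>"
    using T before at(2) by (auto simp: visit_ends_def)
  have le: "b = T" if b: "b \<in> visit_ends A y \<omega>" "b \<le> t" for b
  proof -
    obtain a where a: "0 \<le> a" "a < b" "\<And>s. a \<le> s \<Longrightarrow> s < b \<Longrightarrow> \<omega> s = Some y" "\<omega> b \<noteq> Some y"
      using b(1) by (force simp: visit_ends_def)
    have "T \<le> b"
      using before[of b] a by force
    moreover have "\<not> T < b"
      using a(2) a(3)[of "max a T"] at(1)[of "max a T"] at(2) b(2) by auto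
    ultimately show ?thesis
      by simp
  qed
  show ?thesis
  proof (cases "\<omega> T \<in> Some ` A")
    case True
    have "b = T" if b: "b \<in> visit_ends A y \<omega>" for b
    proof (cases "b \<le> t")
      case False
      then have "\<omega> T \<notin> Some ` A"
        using b T by (auto simp: visit_ends_def)
      with True show ?thesis
        by simp
    qed (use le b in blast)
    with T_in have "visit_ends A y \<omega> = {T}"
      by blast
    moreover have "path_shift t \<omega> 0 \<in> Some ` A"
      using True at(1)[of t] T by simp
    ultimately show ?thesis
      by (simp add: num_visits_def[of A y \<omega>] num_visits_eq_0[of 0])
  next
    case False
    have "\<omega> s \<notin> Some ` A" if "0 \<le> s" "s < t" for s
      using before[of s] at(1)[of s] that T(3) False by (cases "s < T") auto
    then have shift: "visit_ends A y \<omega> \<inter> {t<..} = (\<lambda>b. b + t) ` visit_ends A y (path_shift t \<omega>)"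
      using T by (intro visit_ends_shift) auto
    have split: "visit_ends A y \<omega> = insert T (visit_ends A y \<omega> \<inter> {t<..})"
      using le T_in by force
    have "emeasure (count_space UNIV) (visit_ends A y \<omega>) =
        emeasure (count_space UNIV) ({T} \<union> (visit_ends A y \<omega> \<inter> {t<..}))"
      using split by simp
    also have "\<dots> = emeasure (count_space UNIV) {T} +
        emeasure (count_space UNIV) (visit_ends A y \<omega> \<inter> {t<..})"
      using T by (intro plus_emeasure[symmetric]) auto
    finally show ?thesis
      by (simp add: num_visits_def shift emeasure_count_space_shift)
  qed
qed

section \<open>A measurable version of the visit count\<close>

lemma emeasure_count_space_grid:
  fixes R :: "real set"
  assumes "R \<subseteq> {0<..}"
  shows "emeasure (count_space UNIV) R =
    (SUP n. \<Sum>k. if R \<inter> {real k / Suc n<..real (Suc k) / Suc n} \<noteq> {} then 1 else 0)"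
    (is "_ = (SUP n. \<Sum>k. ?occ n k)")
proof (rule antisym)
  define cell where "cell n k = {real k / Suc n<..real (Suc k) / Suc n}" for n k
  have in_cell: "x \<in> cell n k \<longleftrightarrow> \<lceil>x * Suc n\<rceil> = int k + 1" for x n k
    by (auto simp: cell_def ceiling_eq_iff field_simps)
  show "(SUP n. \<Sum>k. ?occ n k) \<le> emeasure (count_space UNIV) R"
  proof (rule SUP_least)
    fix n
    have "(\<Sum>k. ?occ n k) \<le> (\<Sum>k. emeasure (count_space UNIV) (R \<inter> cell n k))"
    proof (rule suminf_le)
      fix k
      show "?occ n k \<le> emeasure (count_space UNIV) (R \<inter> cell n k)"
      proof (cases "R \<inter> cell n k = {}")
        case False
        then obtain x where "{x} \<subseteq> R \<inter> cell n k"
          by blast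
        then have "emeasure (count_space UNIV) {x} \<le> emeasure (count_space UNIV) (R \<inter> cell n k)"
          by (intro emeasure_mono) auto
        with False show ?thesis
          by (simp add: cell_def)
      qed (simp add: cell_def)
    qed auto
    also have "\<dots> = emeasure (count_space UNIV) (\<Union>k. R \<inter> cell n k)"
      by (intro suminf_emeasure) (auto simp: disjoint_family_on_def in_cell)
    also have "\<dots> \<le> emeasure (count_space UNIV) R"
      by (intro emeasure_mono) auto
    finally show "(\<Sum>k. ?occ n k) \<le> emeasure (count_space UNIV) R" .
  qed
  \<comment> \<open>A grid of mesh below the smallest distance in \<open>X\<close> separates its
    points. One such grid suffices for a bound on the supremum, so the grids need not be
    nested.\<close>
  have card_le: "of_nat (card X) \<le> (SUP n. \<Sum>k. ?occ n k)" if X: "finite X" "X \<subseteq> R" for X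
  proof -
    \<comment> \<open>Inserting 1 keeps the set nonempty when \<open>X\<close> has at most one
      point; removing 0 discards the diagonal pairs.\<close>
    define D where "D = insert 1 ((\<lambda>(x, y). \<bar>x - y\<bar>) ` (X \<times> X) - {0})"
    define \<delta> where "\<delta> = Min D"
    have "finite D" "D \<noteq> {}"
      using X(1) by (auto simp: D_def)
    then have \<delta>: "0 < \<delta>" "\<And>x y. x \<in> X \<Longrightarrow> y \<in> X \<Longrightarrow> x \<noteq> y \<Longrightarrow> \<delta> \<le> \<bar>x - y\<bar>"
      unfolding \<delta>_def by (auto simp: D_def intro!: Min_le)
    obtain n where n: "1 / real (Suc n) < \<delta>"
      using nat_approx_posE[OF \<delta>(1)] by blast
    \<comment> \<open>Cells are closed on the right, so cell \<open>k\<close> consists of the points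
      whose scaled ceiling is \<open>k + 1\<close>; positivity of the points makes
      \<open>nat\<close> harmless.\<close>
    define k where "k x = nat (\<lceil>x * Suc n\<rceil> - 1)" for x :: real
    have k: "x \<in> cell n (k x)" if "x \<in> X" for x
    proof -
      have "0 < x * Suc n"
        using that X(2) assms by auto
      then have "1 \<le> \<lceil>x * Suc n\<rceil>"
        by linarith
      then show ?thesis
        unfolding in_cell k_def by linarith
    qed
    have "inj_on k X"
    proof (rule inj_onI, rule ccontr)
      fix x y assume xy: "x \<in> X" "y \<in> X" "k x = k y" "x \<noteq> y"
      have "\<bar>x - y\<bar> \<le> 1 / Suc n"
        using k[OF xy(1)] k[OF xy(2)] xy(3) by (auto simp: cell_def field_simps abs_le_iff)
      with n \<delta>(2)[OF xy(1,2,4)] show False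
        by simp
    qed
    then have "of_nat (card X) = (\<Sum>j\<in>k ` X. 1 :: ennreal)"
      by (simp add: card_image)
    also have "\<dots> \<le> (\<Sum>j\<in>k ` X. ?occ n j)"
      using k X(2) by (intro sum_mono) (auto simp: cell_def)
    also have "\<dots> \<le> (\<Sum>j. ?occ n j)"
      using X(1) by (intro sum_le_suminf) auto
    also have "\<dots> \<le> (SUP n. \<Sum>k. ?occ n k)"
      by (rule SUP_upper) simp
    finally show ?thesis .
  qed
  show "emeasure (count_space UNIV) R \<le> (SUP n. \<Sum>k. ?occ n k)"
  proof (cases "finite R")
    case True
    then show ?thesis
      using card_le[of R] by (simp add: emeasure_count_space)
  next
    case False
    have "of_nat m \<le> (SUP n. \<Sum>k. ?occ n k)" for m
      using infinite_arbitrarily_large[OF False, of m] card_le by blast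
    then have "\<not> (SUP n. \<Sum>k. ?occ n k) < top"
      using ennreal_Ex_less_of_nat[of "SUP n. \<Sum>k. ?occ n k"] leD by blast
    then show ?thesis
      by (simp only: not_less top_unique top_greatest)
  qed
qed

text \<open>Only countably many coordinates are needed to decide whether a visit ends in \<open>(p, q]\<close>.\<close>

definition visit_ends_in :: "'v set \<Rightarrow> 'v \<Rightarrow> real \<Rightarrow> real \<Rightarrow> 'v path \<Rightarrow> bool" where
  "visit_ends_in A y p q \<omega> \<longleftrightarrow> (\<exists>s\<in>\<rat> \<inter> {p<..}. \<exists>r\<in>\<rat> \<inter> {s<..q}. \<omega> s = Some y \<and> \<omega> r \<noteq> Some y \<and>
     (\<forall>u\<in>\<rat> \<inter> {0..s}. \<omega> u \<notin> Some ` A))"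

text \<open>A visit ending at \<open>b\<close> is witnessed by a rational \<open>s\<close> inside it
  and a rational \<open>r\<close> at or just after \<open>b\<close>. Conversely, the visit in
  progress at \<open>s\<close> ends no later than \<open>r\<close>, and a hit of \<open>A\<close>
  before \<open>s\<close> would persist until some rational time.\<close>

lemma visit_ends_in_iff:
  assumes reg: "regular_path y \<omega>" and y: "y \<notin> A" and pq: "0 \<le> p" "q \<in> \<rat>"
  shows "visit_ends A y \<omega> \<inter> {p<..q} \<noteq> {} \<longleftrightarrow> visit_ends_in A y p q \<omega>"
proof
  have rc: "right_constant_path \<omega>"
    using reg by (simp add: regular_path_def)
  {
    assume "visit_ends A y \<omega> \<inter> {p<..q} \<noteq> {}"
    then obtain b where "b \<in> visit_ends A y \<omega>" "b \<in> {p<..q}"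
      by blast
    then obtain a where b: "p < b" "b \<le> q" "\<omega> b \<noteq> Some y"
      and a: "0 \<le> a" "a < b" "\<And>s. a \<le> s \<Longrightarrow> s < b \<Longrightarrow> \<omega> s = Some y"
      and no_A: "\<And>s. 0 \<le> s \<Longrightarrow> s < b \<Longrightarrow> \<omega> s \<notin> Some ` A"
      unfolding visit_ends_def by auto
    obtain s where s: "s \<in> \<rat>" "max a p < s" "s < b"
      using Rats_dense_in_real[of "max a p" b] a b by auto
    have "\<exists>r\<in>\<rat>. b \<le> r \<and> r \<le> q \<and> \<omega> r \<noteq> Some y"
    proof (cases "b = q")
      case False
      have ys: "\<omega> s = Some y" "0 \<le> s"
        using a s by auto
      obtain b' where b': "s < b'" "\<omega> b' \<noteq> Some y" "\<omega> b' \<noteq> None" "\<And>u. s \<le> u \<Longrightarrow> u < b' \<Longrightarrow> \<omega> u = Some y"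
        using visit_end_exists[OF reg ys(2,1)] by blast
      \<comment> \<open>Membership in \<open>visit_ends\<close> does not say that the path is at a
        vertex at \<open>b\<close>; regularity supplies this for \<open>b'\<close>, and only then
        can a rational time just after \<open>b\<close> be found.\<close>
      have "b' = b"
        using b'(1,2) b'(4)[of b] b(3) a(3)[of b'] s by (cases b b' rule: linorder_cases) auto
      then have "0 \<le> b" "\<omega> b \<noteq> None" "b < q"
        using b'(3) a b(2) False by auto
      then obtain r where r: "r \<in> \<rat>" "b < r" "r < q" "\<And>s. b \<le> s \<Longrightarrow> s \<le> r \<Longrightarrow> \<omega> s = \<omega> b"
        using rational_just_after[OF rc] by blast
      have "\<omega> r \<noteq> Some y"
        using r(2) r(4)[of r] b(3) by simp
      with r(1-3) show ?thesis
        by (intro bexI[of _ r]) auto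
    qed (use b pq in auto)
    then obtain r where r: "r \<in> \<rat>" "b \<le> r" "r \<le> q" "\<omega> r \<noteq> Some y"
      by blast
    have "\<omega> s = Some y" "s \<in> \<rat> \<inter> {p<..}" "r \<in> \<rat> \<inter> {s<..q}" "\<forall>u\<in>\<rat> \<inter> {0..s}. \<omega> u \<notin> Some ` A"
      using s a(3)[of s] no_A r by auto
    then show "visit_ends_in A y p q \<omega>"
      using r(4) unfolding visit_ends_in_def by blast
  next
    assume "visit_ends_in A y p q \<omega>"
    then obtain s r where s: "s \<in> \<rat>" "r \<in> \<rat>" "p < s" "s < r" "r \<le> q" "\<omega> s = Some y" "\<omega> r \<noteq> Some y"
      and no_A: "\<And>u. u \<in> \<rat> \<Longrightarrow> 0 \<le> u \<Longrightarrow> u \<le> s \<Longrightarrow> \<omega> u \<notin> Some ` A"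
      unfolding visit_ends_in_def by (metis IntE atLeastAtMost_iff greaterThanAtMost_iff greaterThan_iff IntI)
    have s0: "0 \<le> s"
      using s pq by simp
    obtain b where b: "s < b" "\<omega> b \<noteq> Some y" "\<And>u. s \<le> u \<Longrightarrow> u < b \<Longrightarrow> \<omega> u = Some y"
      using visit_end_exists[OF reg s0 s(6)] by blast
    have "b \<le> r"
      using b(3)[of r] s by force
    have "\<omega> u \<notin> Some ` A" if u: "0 \<le> u" "u < b" for u
    proof (cases "u < s")
      case True
      show ?thesis
      proof
        assume hit: "\<omega> u \<in> Some ` A"
        then have "\<omega> u \<noteq> None"
          by auto
        then obtain v where v: "v \<in> \<rat>" "u < v" "v < s" "\<And>s. u \<le> s \<Longrightarrow> s \<le> v \<Longrightarrow> \<omega> s = \<omega> u"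
          using rational_just_after[OF rc u(1) _ True] by blast
        have "\<omega> v = \<omega> u"
          using v(4)[of v] v(2) by simp
        with no_A[of v] hit u v(1-3) show False
          by simp
      qed
    qed (use b(3)[of u] u y in auto)
    with b s s0 \<open>b \<le> r\<close> have "b \<in> visit_ends A y \<omega> \<inter> {p<..q}"
      by (auto simp: visit_ends_def)
    then show "visit_ends A y \<omega> \<inter> {p<..q} \<noteq> {}"
      by blast
  }
qed

text \<open>This is \<open>F\<close>-measurable by construction, and it replaces
  \<open>num_visits\<close> on regular paths, that is, almost surely.\<close>

definition grid_visits :: "'v set \<Rightarrow> 'v \<Rightarrow> 'v path \<Rightarrow> ennreal" where
  "grid_visits A y \<omega> =
     (SUP n. \<Sum>k. if visit_ends_in A y (real k / Suc n) (real (Suc k) / Suc n) \<omega> then 1 else 0)"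

lemma grid_visits_eq:
  assumes "regular_path y \<omega>" "y \<notin> A"
  shows "grid_visits A y \<omega> = num_visits A y \<omega>"
proof -
  have "visit_ends A y \<omega> \<subseteq> {0<..}"
    by (auto simp: visit_ends_def)
  then show ?thesis
    unfolding num_visits_def grid_visits_def
    by (simp add: emeasure_count_space_grid visit_ends_in_iff[OF assms] del: of_nat_Suc)
qed

section \<open>The strong Markov property\<close>

lemma (in finite_measure) has_sum_measure_countable_UN:
  assumes "countable I" "\<And>i. i \<in> I \<Longrightarrow> B i \<in> sets M" "disjoint_family_on B I"
  shows "((\<lambda>i. measure M (B i)) has_sum measure M (\<Union>i\<in>I. B i)) I"
proof -
  define N where "N = to_nat_on I ` I"
  define D where "D n = (if n \<in> N then B (from_nat_into I n) else {})" for n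
  have inj: "inj_on (to_nat_on I) I"
    using assms(1) by (rule inj_on_to_nat_on)
  have D: "D (to_nat_on I i) = B i" if "i \<in> I" for i
    using that assms(1) by (simp add: D_def N_def)
  have UN: "(\<Union>n. D n) = (\<Union>i\<in>I. B i)"
  proof
    show "(\<Union>n. D n) \<subseteq> (\<Union>i\<in>I. B i)"
      using D by (auto simp: D_def N_def assms(1) split: if_splits)
    show "(\<Union>i\<in>I. B i) \<subseteq> (\<Union>n. D n)"
      using D by blast
  qed
  have "range D \<subseteq> sets M"
    using assms(1,2) by (auto simp: D_def N_def)
  moreover have "disjoint_family D"
    using assms(1,3) by (fastforce simp: disjoint_family_on_def D_def N_def)
  ultimately have "(\<lambda>n. measure M (D n)) sums measure M (\<Union>n. D n)"
    by (rule finite_measure_UNION)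
  then have "((\<lambda>n. measure M (D n)) has_sum measure M (\<Union>n. D n)) UNIV"
    by (rule sums_nonneg_imp_has_sum) simp
  then have "((\<lambda>n. measure M (D n)) has_sum measure M (\<Union>n. D n)) N"
    by (subst has_sum_cong_neutral[where T = UNIV]) (auto simp: D_def)
  then have "((\<lambda>i. measure M (D (to_nat_on I i))) has_sum measure M (\<Union>n. D n)) I"
    unfolding N_def by (subst (asm) has_sum_reindex[OF inj]) (simp add: o_def)
  then show ?thesis
    unfolding UN by (rule has_sum_cong[THEN iffD1, rotated]) (simp add: D)
qed

lemma (in finite_measure) measure_tendsto_eventually_AE:
  assumes "\<And>n. V n \<in> sets M" "Q \<in> sets M"
    and "AE \<omega> in M. \<forall>\<^sub>F n in sequentially. \<omega> \<in> V n \<longleftrightarrow> \<omega> \<in> Q"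
  shows "(\<lambda>n. measure M (V n)) \<longlonglongrightarrow> measure M Q"
proof -
  have "(\<lambda>n. integral\<^sup>L M (indicat_real (V n))) \<longlonglongrightarrow> integral\<^sup>L M (indicat_real Q)"
  proof (rule integral_dominated_convergence[where w = "\<lambda>_. 1"])
    show "AE \<omega> in M. (\<lambda>n. indicat_real (V n) \<omega>) \<longlonglongrightarrow> indicat_real Q \<omega>"
      using assms(3)
    proof eventually_elim
      case (elim \<omega>)
      then have "\<forall>\<^sub>F n in sequentially. indicat_real (V n) \<omega> = indicat_real Q \<omega>"
        by eventually_elim (simp add: indicator_def)
      then show ?case
        by (rule tendsto_eventually)
    qed
  qed (use assms in auto)
  then show ?thesis
    using assms by (simp add: Int_absorb2 sets.sets_into_space)
qed

locale reflected_network = reflected_walk E c w F P + network E c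
  for E :: "'v::countable set set" and c :: "'v set \<Rightarrow> real"
    and w :: "'v \<Rightarrow> real" and F :: "'v path measure" and P :: "'v \<Rightarrow> 'v path measure"
begin

sublocale P: prob_space "P z" for z
  by (rule prob_space_P)

sublocale completion_P: prob_space "completion (P z)" for z
  by (rule P.prob_space_completion)

lemma space_P [simp]: "space (P z) = space F"
  by (rule sets_eq_imp_space_eq[OF sets_P])

section \<open>Events of the past and the Markov property at fixed times\<close>

lemma pred_coordinate [measurable]: "0 \<le> t \<Longrightarrow> Measurable.pred F (\<lambda>\<omega>. R (\<omega> t))"
  using measurable_compose[OF coordinate_measurable, of t R "count_space UNIV"] by simp

lemma space_past [simp]: "space (past F t) = space F"
  by (simp add: past_def)

lemma restrict_measurable_past:
  "(\<lambda>\<omega>. restrict \<omega> {0..t}) \<in> past F t \<rightarrow>\<^sub>M (\<Pi>\<^sub>M s\<in>{0..t}. count_space UNIV)"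
  unfolding past_def by (rule measurable_vimage_algebra1) (auto simp: space_PiM)

lemma pred_past [measurable]:
  assumes "0 \<le> s" "s \<le> t"
  shows "Measurable.pred (past F t) (\<lambda>\<omega>. R (\<omega> s))"
proof -
  have "(\<lambda>f. f s) \<in> (\<Pi>\<^sub>M s\<in>{0..t}. count_space UNIV) \<rightarrow>\<^sub>M count_space (UNIV :: 'v option set)"
    using assms by (intro measurable_component_singleton) auto
  from measurable_compose[OF restrict_measurable_past this]
  have "(\<lambda>\<omega>. restrict \<omega> {0..t} s) \<in> past F t \<rightarrow>\<^sub>M count_space (UNIV :: 'v option set)" .
  then have "(\<lambda>\<omega>. \<omega> s) \<in> past F t \<rightarrow>\<^sub>M count_space (UNIV :: 'v option set)"
    using assms by simp
  from measurable_compose[OF this, of R "count_space UNIV"] show ?thesis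
    by simp
qed

lemma subalgebra_past: "subalgebra (P z) (past F t)"
  unfolding subalgebra_def
proof
  have "(\<lambda>\<omega>. \<lambda>s\<in>{0..t}. \<omega> s) \<in> F \<rightarrow>\<^sub>M (\<Pi>\<^sub>M s\<in>{0..t}. count_space UNIV)"
    by (intro measurable_restrict coordinate_measurable) auto
  then have "(\<lambda>\<omega>. restrict \<omega> {0..t}) -` B \<inter> space F \<in> sets F"
    if "B \<in> sets (\<Pi>\<^sub>M s\<in>{0..t}. count_space UNIV)" for B
    using that by (auto intro: measurable_sets)
  then show "sets (past F t) \<subseteq> sets (P z)"
    unfolding past_def sets_P
    by (subst sets_vimage_algebra2) (auto simp: space_PiM)
qed simp

text \<open>The integrated form of \<open>markov\<close>: the conditional expectation is integrated
  over the past event \<open>H\<close> intersected with \<open>\<omega> t = Some x\<close>, where it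
  is almost surely constant.\<close>

lemma markov_set:
  assumes t: "0 \<le> t" and H: "H \<in> sets (past F t)" and C: "C \<in> sets F"
  shows "measure (P z) {\<omega> \<in> H. \<omega> t = Some x \<and> path_shift t \<omega> \<in> C} =
    measure (P z) {\<omega> \<in> H. \<omega> t = Some x} * measure (P x) C"
proof -
  interpret finite_measure_subalgebra "P z" "past F t"
    by unfold_locales (rule subalgebra_past)
  define H' where "H' = {\<omega> \<in> H. \<omega> t = Some x}"
  have "{\<omega> \<in> space (past F t). \<omega> \<in> H \<and> \<omega> t = Some x} \<in> sets (past F t)"
    using t H by measurable
  moreover have "{\<omega> \<in> space (past F t). \<omega> \<in> H \<and> \<omega> t = Some x} = H'"
    using sets.sets_into_space[OF H] by (auto simp: H'_def)
  ultimately have H': "H' \<in> sets (past F t)"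
    by simp
  then have H'_P: "H' \<in> sets (P z)"
    using subalgebra_past by (auto simp: subalgebra_def)
  have C_P: "C \<in> sets (P x)"
    using C by (simp add: sets_P)
  define S where "S = path_shift t -` C \<inter> space F"
  have S: "S \<in> sets (P z)"
    unfolding S_def sets_P using shift_measurable[OF t] C by (rule measurable_sets)
  define f where "f \<omega> = indicat_real C (path_shift t \<omega>)" for \<omega>
  have f_S: "f \<omega> = indicat_real S \<omega>" if "\<omega> \<in> space (P z)" for \<omega>
    using that by (simp add: f_def S_def indicator_def)
  have f_int: "integrable (P z) f"
    using S by (subst Bochner_Integration.integrable_cong[OF refl f_S])
      (simp_all add: integrable_real_indicator P.emeasure_eq_measure)
  have "(\<integral>\<omega>\<in>H'. f \<omega> \<partial>P z) = (\<integral>\<omega>\<in>H'. real_cond_exp (P z) (past F t) f \<omega> \<partial>P z)"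
    by (rule real_cond_exp_intA[OF f_int H'])
  also have "\<dots> = (\<integral>\<omega>\<in>H'. measure (P x) C \<partial>P z)"
  proof (rule set_lebesgue_integral_cong_AE)
    show "AE \<omega> in P z. \<omega> \<in> H' \<longrightarrow> real_cond_exp (P z) (past F t) f \<omega> = measure (P x) C"
      using markov[OF t C, where z = z and x = x] unfolding f_def by eventually_elim (auto simp: H'_def)
  qed (use H'_P in simp_all)
  also have "\<dots> = measure (P z) H' * measure (P x) C"
    using H'_P sets.sets_into_space[OF H'_P] by (simp add: set_lebesgue_integral_def Int_absorb2)
  also have "(\<integral>\<omega>\<in>H'. f \<omega> \<partial>P z) = (\<integral>\<omega>. indicat_real (H' \<inter> S) \<omega> \<partial>P z)"
    unfolding set_lebesgue_integral_def
    by (rule Bochner_Integration.integral_cong) (auto simp: f_S indicator_def)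
  also have "\<dots> = measure (P z) (H' \<inter> S)"
    using H'_P S sets.sets_into_space[OF S] by (simp add: Int_absorb2 le_infI2)
  also have "H' \<inter> S = {\<omega> \<in> H. \<omega> t = Some x \<and> path_shift t \<omega> \<in> C}"
    using sets.sets_into_space[OF H] by (auto simp: H'_def S_def)
  finally show ?thesis
    by (simp add: H'_def)
qed

text \<open>The exceptional paths need not form a set in \<open>F\<close>, so they are first
  enclosed in a null set of \<open>F\<close>; the Markov property then shows that the path shifted
  by a fixed time avoids it.\<close>

lemma AE_path_shift:
  assumes t: "0 \<le> t" and ae: "\<And>x. AE \<omega> in P x. \<Phi> x \<omega>"
  shows "AE \<omega> in P z. \<forall>x. \<omega> t = Some x \<longrightarrow> \<Phi> x (path_shift t \<omega>)"
  unfolding AE_all_countable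
proof
  fix x
  obtain N where N: "{\<omega> \<in> space (P x). \<not> \<Phi> x \<omega>} \<subseteq> N" "emeasure (P x) N = 0" "N \<in> sets (P x)"
    using AE_E[OF ae[of x]] by blast
  have N_F: "N \<in> sets F"
    using N(3) by (simp add: sets_P)
  define B where "B = {\<omega> \<in> space F. \<omega> t = Some x \<and> path_shift t \<omega> \<in> N}"
  have "space F \<in> sets (past F t)"
    using sets.top[of "past F t"] by simp
  from markov_set[OF t this N_F, where x = x and z = z] have "measure (P z) B = 0"
    using N(2) by (simp add: B_def measure_def)
  moreover have "B \<in> sets (P z)"
    unfolding B_def sets_P using shift_measurable[OF t] N_F t by measurable
  ultimately have "B \<in> null_sets (P z)"
    by (simp add: P.emeasure_eq_measure null_setsI)
  then show "AE \<omega> in P z. \<omega> t = Some x \<longrightarrow> \<Phi> x (path_shift t \<omega>)"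
  proof (rule AE_I')
    show "{\<omega> \<in> space (P z). \<not> (\<omega> t = Some x \<longrightarrow> \<Phi> x (path_shift t \<omega>))} \<subseteq> B"
      using N(1) measurable_space[OF shift_measurable[OF t]] by (auto simp: B_def)
  qed
qed

text \<open>The strong Markov property at a random time \<open>T\<close> follows from the one at fixed times by
  approximating \<open>T\<close> from above on the grids \<open>\<nat> / (n + 1)\<close>, since the path is constant on a
  neighbourhood to the right of \<open>T\<close>.\<close>

lemma strong_markov:
  fixes T :: "'v path \<Rightarrow> real"
  assumes C: "C \<in> sets F" and C': "C' \<in> sets F"
    and K: "\<And>s t. 0 \<le> s \<Longrightarrow> s \<le> t \<Longrightarrow> Measurable.pred (past F t) (K s)"
    and K_iff: "AE \<omega> in P z. \<forall>t\<in>\<rat>. 0 \<le> t \<longrightarrow> K t \<omega> = (T \<omega> \<le> t)"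
    and T: "AE \<omega> in P z. 0 \<le> T \<omega> \<and> (\<exists>\<delta>>0. \<forall>s\<in>{T \<omega>..T \<omega> + \<delta>}. \<omega> s = \<omega> (T \<omega>))"
    and C_iff: "AE \<omega> in P z. \<omega> (T \<omega>) = Some x \<longrightarrow>
      (\<exists>\<delta>>0. \<forall>t\<in>\<rat>. T \<omega> \<le> t \<longrightarrow> t \<le> T \<omega> + \<delta> \<longrightarrow> (path_shift t \<omega> \<in> C \<longleftrightarrow> \<omega> \<in> C'))"
  shows "{\<omega> \<in> space F. \<omega> (T \<omega>) = Some x} \<in> sets (completion (P z))"
    and "measure (completion (P z)) {\<omega> \<in> space F. \<omega> (T \<omega>) = Some x \<and> \<omega> \<in> C'} =
      measure (completion (P z)) {\<omega> \<in> space F. \<omega> (T \<omega>) = Some x} * measure (P x) C"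
proof -
  define g where "g n j = real j / Suc n" for n j
  have g_Rats: "g n j \<in> \<rat>" and g_nonneg: "0 \<le> g n j" for n j
    by (auto simp: g_def simp del: of_nat_Suc)
  have g_mono: "i \<le> j \<Longrightarrow> g n i \<le> g n j" for i j n
    by (simp add: g_def divide_right_mono)
  \<comment> \<open>Almost surely this says that \<open>g n j\<close> is the first grid time not
    before \<open>T\<close>. It is phrased with \<open>K\<close> because \<open>K t\<close> is
    decided by the past of \<open>t\<close>, while \<open>T \<omega> \<le> t\<close> agrees with it
    only almost surely.\<close>
  define J where "J n j = {\<omega> \<in> space F. K (g n j) \<omega> \<and> (\<forall>i<j. \<not> K (g n i) \<omega>)}" for n j
  have J: "J n j \<in> sets (past F (g n j))" for n j
  proof -
    have K': "Measurable.pred (past F (g n j)) (K (g n i))" if "i \<le> j" for i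
      using that by (intro K g_nonneg g_mono)
    have "Measurable.pred (past F (g n j)) (\<lambda>\<omega>. \<forall>i\<in>{..<j}. \<not> K (g n i) \<omega>)"
      by (intro pred_intros_countable_bounded pred_intros_logic K') auto
    then have "Measurable.pred (past F (g n j)) (\<lambda>\<omega>. K (g n j) \<omega> \<and> (\<forall>i\<in>{..<j}. \<not> K (g n i) \<omega>))"
      by (intro pred_intros_logic K') auto
    then have "{\<omega> \<in> space (past F (g n j)). K (g n j) \<omega> \<and> (\<forall>i\<in>{..<j}. \<not> K (g n i) \<omega>)} \<in> sets (past F (g n j))"
      by (rule predE)
    moreover have "{\<omega> \<in> space (past F (g n j)). K (g n j) \<omega> \<and> (\<forall>i\<in>{..<j}. \<not> K (g n i) \<omega>)} = J n j"
      by (auto simp: J_def)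
    ultimately show ?thesis
      by simp
  qed
  have J_F: "J n j \<in> sets F" for n j
    using J[of n j] subalgebra_past[of z "g n j"] by (auto simp: subalgebra_def sets_P)
  have J_disj: "i = j" if "\<omega> \<in> J n i" "\<omega> \<in> J n j" for n i j \<omega>
    using that by (cases i j rule: linorder_cases) (auto simp: J_def)
  define V where "V n j = {\<omega> \<in> J n j. \<omega> (g n j) = Some x}" for n j
  define W where "W n j = {\<omega> \<in> J n j. \<omega> (g n j) = Some x \<and> path_shift (g n j) \<omega> \<in> C}" for n j
  have V: "V n j \<in> sets F" for n j
  proof -
    have "{\<omega> \<in> space F. \<omega> \<in> J n j \<and> \<omega> (g n j) = Some x} \<in> sets F"
      using J_F g_nonneg by measurable
    moreover have "{\<omega> \<in> space F. \<omega> \<in> J n j \<and> \<omega> (g n j) = Some x} = V n j"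
      by (auto simp: V_def J_def)
    ultimately show ?thesis
      by simp
  qed
  have W: "W n j \<in> sets F" for n j
  proof -
    have "path_shift (g n j) -` C \<inter> space F \<in> sets F"
      using shift_measurable[OF g_nonneg] C by (rule measurable_sets)
    then have "V n j \<inter> (path_shift (g n j) -` C \<inter> space F) \<in> sets F"
      using V by blast
    moreover have "V n j \<inter> (path_shift (g n j) -` C \<inter> space F) = W n j"
      by (auto simp: V_def W_def J_def)
    ultimately show ?thesis
      by simp
  qed
  \<comment> \<open>On each \<open>J n j\<close> the approximating time is the constant
    \<open>g n j\<close>, so the fixed-time property applies, and the disjoint pieces are
    summed.\<close>
  have W_V: "measure (P z) (\<Union>j. W n j) = measure (P z) (\<Union>j. V n j) * measure (P x) C" for n
  proof -
    have "(\<lambda>j. measure (P z) (V n j)) sums measure (P z) (\<Union>j. V n j)"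
      using V J_disj by (intro P.finite_measure_UNION) (auto simp: sets_P disjoint_family_on_def V_def)
    then have "(\<lambda>j. measure (P z) (V n j) * measure (P x) C) sums
        (measure (P z) (\<Union>j. V n j) * measure (P x) C)"
      by (rule sums_mult2)
    moreover have "(\<lambda>j. measure (P z) (W n j)) sums measure (P z) (\<Union>j. W n j)"
      using W J_disj by (intro P.finite_measure_UNION) (auto simp: sets_P disjoint_family_on_def W_def)
    moreover have "measure (P z) (W n j) = measure (P z) (V n j) * measure (P x) C" for j
      unfolding V_def W_def by (rule markov_set[OF g_nonneg J C])
    ultimately show ?thesis
      using sums_unique2 by simp
  qed
  \<comment> \<open>The limit inferior of the approximating events is a version in \<open>F\<close>
    of \<open>\<omega> (T \<omega>) = Some x\<close>, an event guaranteed to be measurable only for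
    the completion.\<close>
  define Q where "Q = (\<Union>m. \<Inter>n\<in>{m..}. \<Union>j. V n j)"
  have UV: "(\<Union>j. V n j) \<in> sets F" and UW: "(\<Union>j. W n j) \<in> sets F" for n
    using V W by blast+
  have "Q \<in> sets F"
    unfolding Q_def
    by (intro sets.countable_UN sets.countable_INT' image_subsetI UV) auto
  have ae: "AE \<omega> in P z. (\<forall>\<^sub>F n in sequentially. \<omega> \<in> (\<Union>j. V n j) \<longleftrightarrow> \<omega> (T \<omega>) = Some x) \<and>
    (\<forall>\<^sub>F n in sequentially. \<omega> \<in> (\<Union>j. W n j) \<longleftrightarrow> \<omega> (T \<omega>) = Some x \<and> \<omega> \<in> C')"
    using K_iff T C_iff AE_space
  proof eventually_elim
    case (elim \<omega>)
    have T0: "0 \<le> T \<omega>"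
      using elim by blast
    obtain \<delta>1 where \<delta>1: "0 < \<delta>1" "\<forall>s\<in>{T \<omega>..T \<omega> + \<delta>1}. \<omega> s = \<omega> (T \<omega>)"
      using elim by blast
    obtain \<delta>2 where \<delta>2: "0 < \<delta>2" "\<omega> (T \<omega>) = Some x \<longrightarrow> 
        (\<forall>t\<in>\<rat>. T \<omega> \<le> t \<longrightarrow> t \<le> T \<omega> + \<delta>2 \<longrightarrow> (path_shift t \<omega> \<in> C \<longleftrightarrow> \<omega> \<in> C'))"
      using elim(3) zero_less_one by blast
    define j where "j n = nat \<lceil>T \<omega> * Suc n\<rceil>" for n
    have le_iff: "T \<omega> \<le> g n i \<longleftrightarrow> j n \<le> i" for n i
      by (simp add: g_def j_def field_simps nat_le_iff ceiling_le_iff del: of_nat_Suc)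
    have g_le: "g n (j n) \<le> T \<omega> + 1 / Suc n" for n
    proof -
      have "real (j n) \<le> T \<omega> * Suc n + 1"
        using T0 by (simp add: j_def)
      then have "g n (j n) \<le> (T \<omega> * Suc n + 1) / Suc n"
        unfolding g_def by (rule divide_right_mono) simp
      also have "\<dots> = T \<omega> + 1 / Suc n"
        by (simp add: add_divide_distrib del: of_nat_Suc)
      finally show ?thesis .
    qed
    have in_J: "\<omega> \<in> J n i \<longleftrightarrow> i = j n" for n i
    proof -
      have K_g: "K (g n i) \<omega> \<longleftrightarrow> j n \<le> i" for i
        using elim(1) g_Rats g_nonneg by (simp add: le_iff)
      show ?thesis
        using elim(4) by (auto simp: J_def K_g not_le intro: antisym leI)
    qed
    have "\<forall>\<^sub>F n in sequentially. 1 / real (Suc n) < min \<delta>1 \<delta>2"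
      using \<delta>1(1) \<delta>2(1) by (intro order_tendstoD(2)[OF LIMSEQ_Suc[OF lim_const_over_n]]) simp
    then have good: "\<forall>\<^sub>F n in sequentially. \<omega> (g n (j n)) = \<omega> (T \<omega>) \<and>
        (\<omega> (T \<omega>) = Some x \<longrightarrow> (path_shift (g n (j n)) \<omega> \<in> C \<longleftrightarrow> \<omega> \<in> C'))"
    proof eventually_elim
      case (elim n)
      then have g: "T \<omega> \<le> g n (j n)" "g n (j n) \<le> T \<omega> + \<delta>1" "g n (j n) \<le> T \<omega> + \<delta>2"
        using g_le[of n] le_iff[of n "j n"] by auto
      then have "\<omega> (g n (j n)) = \<omega> (T \<omega>)"
        using bspec[OF \<delta>1(2), of "g n (j n)"] by simp
      then show ?case
        using \<delta>2(2) g(1,3) g_Rats[of n "j n"] by blast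
    qed
    show ?case
    proof
      show "\<forall>\<^sub>F n in sequentially. \<omega> \<in> (\<Union>j. V n j) \<longleftrightarrow> \<omega> (T \<omega>) = Some x"
        using good by eventually_elim (auto simp: V_def in_J)
      show "\<forall>\<^sub>F n in sequentially. \<omega> \<in> (\<Union>j. W n j) \<longleftrightarrow> \<omega> (T \<omega>) = Some x \<and> \<omega> \<in> C'"
        using good by eventually_elim (auto simp: W_def in_J)
    qed
  qed
  have Q_iff: "AE \<omega> in P z. \<omega> \<in> Q \<longleftrightarrow> \<omega> (T \<omega>) = Some x"
    using ae AE_space
  proof eventually_elim
    case (elim \<omega>)
    then obtain m where m: "\<And>n. n \<ge> m \<Longrightarrow> \<omega> \<in> (\<Union>j. V n j) \<longleftrightarrow> \<omega> (T \<omega>) = Some x"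
      unfolding eventually_sequentially by blast
    show ?case
    proof
      assume "\<omega> \<in> Q"
      then obtain m' where "\<omega> \<in> (\<Inter>n\<in>{m'..}. \<Union>j. V n j)"
        unfolding Q_def by (rule UN_E)
      then have "\<omega> \<in> (\<Union>j. V (max m m') j)"
        by (rule INT_D) simp
      then show "\<omega> (T \<omega>) = Some x"
        using m[of "max m m'"] by simp
    next
      assume at_T: "\<omega> (T \<omega>) = Some x"
      have "\<omega> \<in> (\<Union>j. V n j)" if "n \<in> {m..}" for n
        using m[of n] that at_T by (simp only: atLeast_iff)
      then have "\<omega> \<in> (\<Inter>n\<in>{m..}. \<Union>j. V n j)"
        by (rule INT_I)
      then show "\<omega> \<in> Q"
        unfolding Q_def by (rule UN_I[OF UNIV_I])
    qed
  qed
  have "AE \<omega> in P z. \<forall>\<^sub>F n in sequentially. \<omega> \<in> (\<Union>j. V n j) \<longleftrightarrow> \<omega> \<in> Q"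
    using ae Q_iff by eventually_elim simp
  then have V_lim: "(\<lambda>n. measure (P z) (\<Union>j. V n j)) \<longlonglongrightarrow> measure (P z) Q"
    using UV \<open>Q \<in> sets F\<close> by (intro P.measure_tendsto_eventually_AE) (simp_all add: sets_P)
  have "AE \<omega> in P z. \<forall>\<^sub>F n in sequentially. \<omega> \<in> (\<Union>j. W n j) \<longleftrightarrow> \<omega> \<in> Q \<inter> C'"
    using ae Q_iff by eventually_elim simp
  then have "(\<lambda>n. measure (P z) (\<Union>j. W n j)) \<longlonglongrightarrow> measure (P z) (Q \<inter> C')"
    using UW \<open>Q \<in> sets F\<close> C' by (intro P.measure_tendsto_eventually_AE) (simp_all add: sets_P)
  moreover have "(\<lambda>n. measure (P z) (\<Union>j. W n j)) \<longlonglongrightarrow> measure (P z) Q * measure (P x) C"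
    unfolding W_V by (intro tendsto_intros V_lim)
  ultimately have Q_C': "measure (P z) (Q \<inter> C') = measure (P z) Q * measure (P x) C"
    by (rule LIMSEQ_unique)
  have Q_P: "Q \<in> sets (P z)" "Q \<inter> C' \<in> sets (P z)"
    using \<open>Q \<in> sets F\<close> C' by (simp_all add: sets_P)
  have ae1: "AE \<omega> in completion (P z). \<omega> \<in> Q \<longleftrightarrow> \<omega> \<in> {\<omega> \<in> space F. \<omega> (T \<omega>) = Some x}"
    unfolding AE_completion_iff using Q_iff AE_space by eventually_elim auto
  have ae2: "AE \<omega> in completion (P z). \<omega> \<in> Q \<inter> C' \<longleftrightarrow> \<omega> \<in> {\<omega> \<in> space F. \<omega> (T \<omega>) = Some x \<and> \<omega> \<in> C'}"
    unfolding AE_completion_iff using Q_iff AE_space by eventually_elim auto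
  have m1: "{\<omega> \<in> space F. \<omega> (T \<omega>) = Some x} \<in> sets (completion (P z))"
    by (rule completion.in_sets_AE[OF ae1]) (use Q_P in auto)
  have m2: "{\<omega> \<in> space F. \<omega> (T \<omega>) = Some x \<and> \<omega> \<in> C'} \<in> sets (completion (P z))"
    by (rule completion.in_sets_AE[OF ae2]) (use Q_P in auto)
  show "{\<omega> \<in> space F. \<omega> (T \<omega>) = Some x} \<in> sets (completion (P z))"
    by (rule m1)
  show "measure (completion (P z)) {\<omega> \<in> space F. \<omega> (T \<omega>) = Some x \<and> \<omega> \<in> C'} =
      measure (completion (P z)) {\<omega> \<in> space F. \<omega> (T \<omega>) = Some x} * measure (P x) C"
    using measure_eq_AE[OF ae1 _ m1] measure_eq_AE[OF ae2 _ m2] Q_C' Q_P by simp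
qed

end

section \<open>The Green function\<close>

lemma pred_countable_Bex:
  assumes "countable I" "\<And>i. i \<in> I \<Longrightarrow> Measurable.pred M (R i)"
  shows "Measurable.pred M (\<lambda>x. \<exists>i\<in>I. R i x)"
  using assms unfolding pred_def by (intro sets.sets_Collect_countable_Ex') auto

lemma pred_countable_Ball:
  assumes "countable I" "\<And>i. i \<in> I \<Longrightarrow> Measurable.pred M (R i)"
  shows "Measurable.pred M (\<lambda>x. \<forall>i\<in>I. R i x)"
proof -
  have "Measurable.pred M (\<lambda>x. \<not> (\<exists>i\<in>I. \<not> R i x))"
    using assms by (intro pred_intros_logic pred_countable_Bex)
  then show ?thesis
    by simp
qed

lemma countable_Rats_Int: "countable (\<rat> \<inter> S :: real set)"
  using countable_rat by (rule countable_subset[rotated]) blast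

text \<open>The tail-sum formula, which turns an expectation into a series of probabilities.\<close>

lemma num_visits_eq_suminf:
  "num_visits A y \<omega> = (\<Sum>m. if of_nat (Suc m) \<le> num_visits A y \<omega> then 1 else 0)"
proof (cases "finite (visit_ends A y \<omega>)")
  case True
  define n where "n = card (visit_ends A y \<omega>)"
  have "num_visits A y \<omega> = of_nat n"
    using True by (simp add: num_visits_def n_def)
  moreover have "(\<Sum>m. if of_nat (Suc m) \<le> (of_nat n :: ennreal) then 1 else (0 :: ennreal)) =
      (\<Sum>m<n. if of_nat (Suc m) \<le> (of_nat n :: ennreal) then 1 else 0)"
    unfolding of_nat_le_iff by (rule suminf_finite) auto
  ultimately show ?thesis
    by (simp add: Suc_le_eq del: of_nat_Suc)
next
  case False
  then have "num_visits A y \<omega> = top"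
    by (simp add: num_visits_def)
  then show ?thesis
    by (simp add: suminf_eq_SUP ennreal_SUP_of_nat_eq_top)
qed

context reflected_network
begin

section \<open>Almost sure regularity of the paths\<close>

lemma transition_has_sum: "((\<lambda>x. c {z, x} / \<pi> z) has_sum 1) {x. adj E z x}"
proof -
  have "((\<lambda>x. c {z, x}) has_sum \<pi> z) {x. adj E z x}"
    using finite_conductance[of z]
    unfolding finite_conductance_at_def total_conductance_def by (rule has_sum_infsum)
  then have "((\<lambda>x. c {z, x} * (1 / \<pi> z)) has_sum \<pi> z * (1 / \<pi> z)) {x. adj E z x}"
    by (rule has_sum_cmult_left)
  then show ?thesis
    using total_conductance_pos[of z] by simp
qed

text \<open>The probabilities in \<open>exit_law\<close> already add up to 1 over the neighbours,
  which leaves no mass for an exit to infinity or to any other vertex.\<close>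

lemma AE_exit_neighbour: "AE \<omega> in P z. \<exists>x. adj E z x \<and> \<omega> (exit_time z \<omega>) = Some x"
proof -
  define B where "B x = {\<omega> \<in> space (P z). \<omega> (exit_time z \<omega>) = Some x}" for x
  define N where "N = {x. adj E z x}"
  have B: "measure (completion (P z)) (B x) = c {z, x} / \<pi> z" if "x \<in> N" for x
    using exit_law[of z x] that by (simp add: B_def N_def)
  have B_sets: "B x \<in> sets (completion (P z))" if "x \<in> N" for x
  proof -
    \<comment> \<open>\<open>measure\<close> is 0 on non-measurable sets, so a positive value in
      \<open>exit_law\<close> proves that the event is measurable.\<close>
    have "0 < c {z, x} / \<pi> z"
      using that conductance_pos total_conductance_pos by (simp add: N_def adj_def)
    then show ?thesis
      using B[OF that] measure_notin_sets by force
  qed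
  have "((\<lambda>x. measure (completion (P z)) (B x)) has_sum measure (completion (P z)) (\<Union>x\<in>N. B x)) N"
    using B_sets
    by (intro completion_P.has_sum_measure_countable_UN) (auto simp: disjoint_family_on_def B_def)
  moreover have "((\<lambda>x. measure (completion (P z)) (B x)) has_sum 1) N"
    using transition_has_sum[of z] unfolding N_def
    by (rule has_sum_cong[THEN iffD1, rotated]) (simp add: B[unfolded N_def])
  ultimately have "measure (completion (P z)) (\<Union>x\<in>N. B x) = 1"
    by (rule has_sum_unique)
  moreover have "(\<Union>x\<in>N. B x) \<in> sets (completion (P z))"
    using B_sets by (intro sets.countable_UN') auto
  ultimately have "AE \<omega> in completion (P z). \<omega> \<in> (\<Union>x\<in>N. B x)"
    by (simp add: completion_P.prob_eq_1)
  then show ?thesis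
    unfolding AE_completion_iff by eventually_elim (auto simp: B_def N_def)
qed

lemma AE_regular_path: "AE \<omega> in P z. regular_path y \<omega>"
proof -
  \<comment> \<open>Regularity concerns visits to \<open>y\<close> alone, so the property is made
    trivial for walks started elsewhere; this gives it the form required by
    \<open>AE_path_shift\<close>.\<close>
  define \<Phi> :: "'v \<Rightarrow> 'v path \<Rightarrow> bool" where
    "\<Phi> x \<omega> \<longleftrightarrow> (x = y \<longrightarrow> has_min (exit_times y \<omega>) \<and> \<omega> (exit_time y \<omega>) \<noteq> None)" for x \<omega>
  have \<Phi>: "AE \<omega> in P x. \<Phi> x \<omega>" for x
    using exit_time_exists[of x] AE_exit_neighbour[of x]
    by eventually_elim (auto simp: \<Phi>_def)
  have "AE \<omega> in P z. \<forall>q\<in>\<rat> \<inter> {0..}. \<forall>x. \<omega> q = Some x \<longrightarrow> \<Phi> x (path_shift q \<omega>)"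
    by (intro AE_ball_countable' AE_path_shift \<Phi> countable_Rats_Int) auto
  with right_constant[of z] show ?thesis
  proof eventually_elim
    case (elim \<omega>)
    show ?case
      unfolding regular_path_def
    proof (intro conjI ballI impI)
      show "right_constant_path \<omega>"
        using elim(1) by (simp only: right_constant_path_def)
    next
      fix q :: real assume q: "q \<in> \<rat>" "0 \<le> q" "\<omega> q = Some y"
      define e where "e = exit_time y (path_shift q \<omega>)"
      have "\<Phi> y (path_shift q \<omega>)"
        using q elim(2) by auto
      then have ex: "has_min (exit_times y (path_shift q \<omega>))" "path_shift q \<omega> e \<noteq> None"
        by (auto simp: \<Phi>_def e_def)
      have e: "0 < e" "path_shift q \<omega> e \<noteq> Some y"
        using exit_time_pos[OF ex(1)] at_exit_time[OF ex(1)] by (simp_all add: e_def)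
      have "\<omega> s = Some y" if "q \<le> s" "s < e + q" for s
        using that q(3) before_exit_time[OF ex(1), of "s - q"] by (cases "s = q") (auto simp: e_def)
      then show "\<exists>b>q. \<omega> b \<noteq> Some y \<and> \<omega> b \<noteq> None \<and> (\<forall>s\<in>{q..<b}. \<omega> s = Some y)"
        using e ex(2) by (intro exI[of _ "e + q"]) auto
    qed
  qed
qed

lemma pred_visit_ends_in:
  assumes "0 \<le> p"
  shows "Measurable.pred F (visit_ends_in A y p q)"
  unfolding visit_ends_in_def[abs_def]
  by (intro pred_countable_Bex pred_countable_Ball pred_intros_logic pred_coordinate countable_Rats_Int)
     (use assms in auto)

lemma borel_measurable_grid_visits [measurable]: "grid_visits A y \<in> borel_measurable F"
proof -
  have [measurable]: "Measurable.pred F (visit_ends_in A y (real k / Suc n) r)" for k n r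
    by (rule pred_visit_ends_in) simp
  show ?thesis
    unfolding grid_visits_def[abs_def] by measurable
qed

text \<open>Built from \<open>grid_visits\<close> so that it lies in \<open>F\<close>, as the Markov
  property requires of its events.\<close>

definition at_least :: "'v set \<Rightarrow> 'v \<Rightarrow> nat \<Rightarrow> 'v path set" where
  "at_least A y m = {\<omega> \<in> space F. of_nat m \<le> grid_visits A y \<omega>}"

lemma sets_at_least: "at_least A y m \<in> sets F"
  unfolding at_least_def by measurable

lemma sets_at_least_completion: "at_least A y m \<in> sets (completion (P z))"
  using sets_at_least by (simp add: sets_completionI_sets sets_P)

section \<open>Decomposition at the first hit and at the first exit\<close>

lemma path_shift_in_space: "\<omega> \<in> space F \<Longrightarrow> 0 \<le> t \<Longrightarrow> path_shift t \<omega> \<in> space F"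
  using measurable_space[OF shift_measurable] by blast

text \<open>A positive number of visits forces the first hit of \<open>insert y A\<close> to occur
  at \<open>y\<close>, an event whose probability \<open>hit_law\<close> identifies as the voltage.
  The strong Markov property then restarts the count from \<open>y\<close>.\<close>

lemma measure_at_least_hit:
  assumes A: "finite A" "y \<notin> A" and m: "0 < m"
  shows "measure (P z) (at_least A y m) = voltage A y z * measure (P y) (at_least A y m)"
proof -
  define B where "B = insert y A"
  define T where "T = hit_time B"
  \<comment> \<open>A hit strictly before \<open>t\<close> persists to a rational time before
    \<open>t\<close>; the time \<open>t\<close> itself is added for a hit exactly at
    \<open>t\<close>.\<close>
  define K where "K t \<omega> \<longleftrightarrow> (\<exists>s\<in>\<rat> \<inter> {0..<t} \<union> {t}. \<omega> s \<in> Some ` B)" for t and \<omega> :: "'v path"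
  have hit: "AE \<omega> in P z. has_min (hit_times B \<omega>)"
    using A by (intro hit_time_exists) (auto simp: B_def)
  note reg = AE_regular_path[of y z]
  have right: "right_constant_path \<omega>" if "regular_path y \<omega>" for \<omega>
    using that by (simp add: regular_path_def)
  have T: "0 \<le> T \<omega>" "\<omega> (T \<omega>) \<in> Some ` B" "\<omega> (T \<omega>) \<noteq> None"
      "\<And>s. 0 \<le> s \<Longrightarrow> s < T \<omega> \<Longrightarrow> \<omega> s \<notin> Some ` B"
    if "has_min (hit_times B \<omega>)" for \<omega>
    using hit_time_nonneg[OF that] at_hit_time[OF that] before_hit_time[OF that] by (auto simp: T_def)
  have K_meas: "Measurable.pred (past F t) (K s)" if "0 \<le> s" "s \<le> t" for s t
    unfolding K_def[abs_def]
    by (intro pred_countable_Bex pred_past countable_Un countable_Rats_Int) (use that in auto)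
  have K_iff: "AE \<omega> in P z. \<forall>t\<in>\<rat>. 0 \<le> t \<longrightarrow> K t \<omega> = (T \<omega> \<le> t)"
    using hit reg
  proof eventually_elim
    case (elim \<omega>)
    note T = T[OF elim(1)]
    have "K t \<omega> = (T \<omega> \<le> t)" if "0 \<le> t" for t
    proof
      assume "K t \<omega>"
      then obtain s where s: "0 \<le> s" "s \<le> t" "\<omega> s \<in> Some ` B"
        using \<open>0 \<le> t\<close> by (auto simp: K_def)
      show "T \<omega> \<le> t"
        using T(4)[OF s(1)] s(2,3) by linarith
    next
      assume le: "T \<omega> \<le> t"
      show "K t \<omega>"
      proof (cases "T \<omega> = t")
        case True
        then show ?thesis
          using T(2) by (auto simp: K_def)
      next
        case False
        then have "T \<omega> < t"
          using le by simp
        then obtain q where q: "q \<in> \<rat>" "T \<omega> < q" "q < t"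
            "\<And>s. T \<omega> \<le> s \<Longrightarrow> s \<le> q \<Longrightarrow> \<omega> s = \<omega> (T \<omega>)"
          using rational_just_after[OF right[OF elim(2)] T(1,3)] by blast
        have "\<omega> q \<in> Some ` B"
          using q(2) q(4)[of q] T(2) by simp
        then show ?thesis
          using q(1-3) T(1) unfolding K_def by (intro bexI[of _ q]) auto
      qed
    qed
    then show ?case
      by blast
  qed
  have T_right: "AE \<omega> in P z. 0 \<le> T \<omega> \<and> (\<exists>\<delta>>0. \<forall>s\<in>{T \<omega>..T \<omega> + \<delta>}. \<omega> s = \<omega> (T \<omega>))"
    using hit reg
  proof eventually_elim
    case (elim \<omega>)
    then show ?case
      using T[OF elim(1)] right[OF elim(2)] unfolding right_constant_path_def by blast
  qed
  have shift: "AE \<omega> in P z. \<omega> (T \<omega>) = Some y \<longrightarrow> (\<exists>\<delta>>0. \<forall>t\<in>\<rat>. T \<omega> \<le> t \<longrightarrow> t \<le> T \<omega> + \<delta> \<longrightarrow>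
      (path_shift t \<omega> \<in> at_least A y m \<longleftrightarrow> \<omega> \<in> at_least A y m))"
    using hit reg T_right AE_space
  proof eventually_elim
    case (elim \<omega>)
    note T = T[OF elim(1)]
    show ?case
    proof
      assume y: "\<omega> (T \<omega>) = Some y"
      obtain \<delta> where \<delta>: "0 < \<delta>" "\<forall>s\<in>{T \<omega>..T \<omega> + \<delta>}. \<omega> s = \<omega> (T \<omega>)"
        using elim(3) by blast
      have "path_shift t \<omega> \<in> at_least A y m \<longleftrightarrow> \<omega> \<in> at_least A y m"
        if t: "t \<in> \<rat>" "T \<omega> \<le> t" "t \<le> T \<omega> + \<delta>" for t
      proof -
        have t0: "0 \<le> t"
          using T(1) t by simp
        have "num_visits A y (path_shift t \<omega>) = num_visits A y \<omega>"
        proof (rule num_visits_shift_first_hit[OF T(1) t(2) A(2)])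
          show "\<omega> s \<notin> Some ` insert y A" if "0 \<le> s" "s < T \<omega>" for s
            using T(4)[OF that] by (simp add: B_def)
          show "\<omega> s = Some y" if "T \<omega> \<le> s" "s \<le> t" for s
            using bspec[OF \<delta>(2), of s] that t(3) y by simp
        qed
        then have "grid_visits A y (path_shift t \<omega>) = grid_visits A y \<omega>"
          using grid_visits_eq[OF elim(2) A(2)] grid_visits_eq[OF regular_path_shift[OF elim(2) t(1) t0] A(2)]
          by simp
        then show ?thesis
          using elim(4) path_shift_in_space[of \<omega> t] t0 by (simp add: at_least_def)
      qed
      with \<delta>(1) show "\<exists>\<delta>>0. \<forall>t\<in>\<rat>. T \<omega> \<le> t \<longrightarrow> t \<le> T \<omega> + \<delta> \<longrightarrow>
          (path_shift t \<omega> \<in> at_least A y m \<longleftrightarrow> \<omega> \<in> at_least A y m)"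
        by blast
    qed
  qed
  define S where "S = {\<omega> \<in> space F. \<omega> (T \<omega>) = Some y}"
  note strong = strong_markov[OF sets_at_least sets_at_least K_meas K_iff T_right shift]
  have S: "S \<in> sets (completion (P z))"
    unfolding S_def by (rule strong(1))
  have S': "S \<inter> at_least A y m \<in> sets (completion (P z))"
    using S sets_at_least_completion by (rule sets.Int)
  have "S \<inter> at_least A y m = {\<omega> \<in> space F. \<omega> (T \<omega>) = Some y \<and> \<omega> \<in> at_least A y m}"
    by (auto simp: S_def)
  then have prod: "measure (completion (P z)) (S \<inter> at_least A y m) =
      measure (completion (P z)) S * measure (P y) (at_least A y m)"
    using strong(2) by (simp add: S_def)
  have voltage: "voltage A y z = measure (completion (P z)) S"
  proof -
    \<comment> \<open>The integrand of \<open>hit_law\<close> contains \<open>the\<close>; almost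
      surely the path is at a vertex when it hits, so this event agrees with
      \<open>S\<close>.\<close>
    define S1 where "S1 = {\<omega> \<in> space F. the (\<omega> (T \<omega>)) = y}"
    have eq: "AE \<omega> in completion (P z). \<omega> \<in> S \<longleftrightarrow> \<omega> \<in> S1"
      unfolding AE_completion_iff using hit AE_space
    proof eventually_elim
      case (elim \<omega>)
      then show ?case
        using T(3)[OF elim(1)] by (auto simp: S_def S1_def)
    qed
    have S1: "S1 \<in> sets (completion (P z))"
      by (rule completion.in_sets_AE[OF eq S]) (auto simp: S1_def)
    have "voltage A y z = (\<integral>\<omega>. indicat_real {y} (the (\<omega> (T \<omega>))) \<partial>completion (P z))"
      unfolding voltage_def T_def B_def using A by (intro hit_law) auto
    also have "\<dots> = (\<integral>\<omega>. indicat_real S1 \<omega> \<partial>completion (P z))"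
      by (rule Bochner_Integration.integral_cong) (auto simp: S1_def indicator_def)
    also have "\<dots> = measure (completion (P z)) S1"
      using sets.sets_into_space[OF S1] by (simp add: Int_absorb2)
    also have "\<dots> = measure (completion (P z)) S"
      using measure_eq_AE[OF eq S S1] by simp
    finally show ?thesis .
  qed
  have "AE \<omega> in P z. \<omega> \<in> at_least A y m \<longleftrightarrow> \<omega> \<in> S \<inter> at_least A y m"
    using hit reg AE_space
  proof eventually_elim
    case (elim \<omega>)
    note T = T[OF elim(1)]
    have "\<omega> (T \<omega>) = Some y" if "\<omega> \<in> at_least A y m"
    proof (rule ccontr)
      assume "\<omega> (T \<omega>) \<noteq> Some y"
      then have "\<omega> (T \<omega>) \<in> Some ` A"
        using T(2) by (auto simp: B_def)
      then have "num_visits A y \<omega> = 0"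
        using T(1,4) by (intro num_visits_eq_0[of "T \<omega>"]) (auto simp: B_def)
      with that m show False
        by (simp add: at_least_def grid_visits_eq[OF elim(2) A(2)])
    qed
    then show ?case
      using elim(3) by (auto simp: S_def)
  qed
  then have "measure (completion (P z)) (at_least A y m) = measure (completion (P z)) (S \<inter> at_least A y m)"
    using S' sets_at_least by (intro measure_eq_AE) (auto simp: sets_P AE_completion_iff)
  then show ?thesis
    using prod voltage sets_at_least by (simp add: sets_P)
qed

text \<open>First-step analysis: started at \<open>y\<close>, the walk completes one visit at its
  exit time and needs \<open>m\<close> more from the neighbour \<open>x\<close> it jumps to. The
  relation is a \<open>has_sum\<close> because \<open>y\<close> may have infinite degree.\<close>

lemma measure_at_least_exit:
  assumes A: "y \<notin> A"
  shows "((\<lambda>x. c {y, x} / \<pi> y * measure (P x) (at_least A y m)) has_sum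
    measure (P y) (at_least A y (Suc m))) {x. adj E y x}"
proof -
  define T where "T = exit_time y"
  \<comment> \<open>Only positive times are inspected, as in \<open>exit_times\<close>; in
    particular \<open>K 0\<close> is false.\<close>
  define K where "K t \<omega> \<longleftrightarrow> (\<exists>s\<in>\<rat> \<inter> {0<..<t} \<union> ({t} \<inter> {0<..}). \<omega> s \<noteq> Some y)" for t and \<omega> :: "'v path"
  note ex = exit_time_exists[of y] AE_exit_neighbour[of y]
  note reg = AE_regular_path[of y y]
  have right: "right_constant_path \<omega>" if "regular_path y \<omega>" for \<omega>
    using that by (simp add: regular_path_def)
  have T: "0 < T \<omega>" "\<omega> (T \<omega>) \<noteq> Some y" "\<And>s. 0 < s \<Longrightarrow> s < T \<omega> \<Longrightarrow> \<omega> s = Some y"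
    if "has_min (exit_times y \<omega>)" for \<omega>
    using exit_time_pos[OF that] at_exit_time[OF that] before_exit_time[OF that] by (auto simp: T_def)
  have K_meas: "Measurable.pred (past F t) (K s)" if "0 \<le> s" "s \<le> t" for s t
    unfolding K_def[abs_def]
    by (intro pred_countable_Bex pred_past countable_Un countable_Rats_Int countable_Int1) (use that in auto)
  have K_iff: "AE \<omega> in P y. \<forall>t\<in>\<rat>. 0 \<le> t \<longrightarrow> K t \<omega> = (T \<omega> \<le> t)"
    using ex reg
  proof eventually_elim
    case (elim \<omega>)
    note T = T[OF elim(1)]
    have vertex: "\<omega> (T \<omega>) \<noteq> None"
      using elim(2) by (auto simp: T_def)
    have "K t \<omega> = (T \<omega> \<le> t)" if "0 \<le> t" for t
    proof
      assume "K t \<omega>"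
      then obtain s where s: "0 < s" "s \<le> t" "\<omega> s \<noteq> Some y"
        by (auto simp: K_def)
      show "T \<omega> \<le> t"
        using T(3)[OF s(1)] s(2,3) by linarith
    next
      assume le: "T \<omega> \<le> t"
      show "K t \<omega>"
      proof (cases "T \<omega> = t")
        case True
        then show ?thesis
          using T(1,2) by (auto simp: K_def)
      next
        case False
        then have "T \<omega> < t"
          using le by simp
        then obtain q where q: "q \<in> \<rat>" "T \<omega> < q" "q < t"
            "\<And>s. T \<omega> \<le> s \<Longrightarrow> s \<le> q \<Longrightarrow> \<omega> s = \<omega> (T \<omega>)"
          using rational_just_after[OF right[OF elim(3)] less_imp_le[OF T(1)] vertex] by blast
        have "\<omega> q \<noteq> Some y"
          using q(2) q(4)[of q] T(2) by simp
        then show ?thesis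
          using q(1-3) T(1) unfolding K_def by (intro bexI[of _ q]) auto
      qed
    qed
    then show ?case
      by blast
  qed
  have T_right: "AE \<omega> in P y. 0 \<le> T \<omega> \<and> (\<exists>\<delta>>0. \<forall>s\<in>{T \<omega>..T \<omega> + \<delta>}. \<omega> s = \<omega> (T \<omega>))"
    using ex reg
  proof eventually_elim
    case (elim \<omega>)
    have "\<omega> (T \<omega>) \<noteq> None" "0 \<le> T \<omega>"
      using elim(2) T(1)[OF elim(1)] by (auto simp: T_def)
    then show ?case
      using right[OF elim(3)] unfolding right_constant_path_def by blast
  qed
  have shift: "AE \<omega> in P y. \<omega> (T \<omega>) = Some x \<longrightarrow> (\<exists>\<delta>>0. \<forall>t\<in>\<rat>. T \<omega> \<le> t \<longrightarrow> t \<le> T \<omega> + \<delta> \<longrightarrow>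
      (path_shift t \<omega> \<in> at_least A y m \<longleftrightarrow> \<omega> \<in> at_least A y (Suc m)))" for x
    using ex(1) reg T_right start[of y] AE_space
  proof eventually_elim
    case (elim \<omega>)
    note T = T[OF elim(1)]
    obtain \<delta> where \<delta>: "0 < \<delta>" "\<forall>s\<in>{T \<omega>..T \<omega> + \<delta>}. \<omega> s = \<omega> (T \<omega>)"
      using elim(3) by blast
    have "path_shift t \<omega> \<in> at_least A y m \<longleftrightarrow> \<omega> \<in> at_least A y (Suc m)"
      if t: "t \<in> \<rat>" "T \<omega> \<le> t" "t \<le> T \<omega> + \<delta>" for t
    proof -
      have t0: "0 \<le> t"
        using T(1) t by simp
      have "num_visits A y \<omega> = 1 + num_visits A y (path_shift t \<omega>)"
      proof (rule num_visits_shift_exit[OF T(1) t(2) A])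
        show "\<omega> (T \<omega>) \<noteq> Some y"
          by (rule T(2))
        \<comment> \<open>The exit time says nothing about time 0, where the value comes from
          \<open>start\<close>.\<close>
        show "\<omega> s = Some y" if "0 \<le> s" "s < T \<omega>" for s
          using T(3)[of s] elim(4) that by (cases "s = 0") auto
        show "\<omega> s = \<omega> (T \<omega>)" if "T \<omega> \<le> s" "s \<le> t" for s
          using bspec[OF \<delta>(2), of s] that t(3) by simp
      qed
      then have "grid_visits A y \<omega> = 1 + grid_visits A y (path_shift t \<omega>)"
        using grid_visits_eq[OF elim(2) A] grid_visits_eq[OF regular_path_shift[OF elim(2) t(1) t0] A]
        by simp
      then show ?thesis
        using elim(5) path_shift_in_space[of \<omega> t] t0
        by (simp add: at_least_def ennreal_add_left_cancel_le)
    qed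
    with \<delta>(1) show ?case
      by blast
  qed
  define S where "S x = {\<omega> \<in> space F. \<omega> (T \<omega>) = Some x}" for x
  note strong = strong_markov[OF sets_at_least sets_at_least K_meas K_iff T_right shift]
  have S': "S x \<inter> at_least A y (Suc m) \<in> sets (completion (P y))" for x
    using strong(1)[of x] sets_at_least_completion unfolding S_def by (rule sets.Int)
  have "S x \<inter> at_least A y (Suc m) = {\<omega> \<in> space F. \<omega> (T \<omega>) = Some x \<and> \<omega> \<in> at_least A y (Suc m)}" for x
    by (auto simp: S_def)
  then have prod: "measure (completion (P y)) (S x \<inter> at_least A y (Suc m)) =
      c {y, x} / \<pi> y * measure (P x) (at_least A y m)" if "adj E y x" for x
    using strong(2)[of x] exit_law[OF that] by (simp add: T_def)
  have "((\<lambda>x. measure (completion (P y)) (S x \<inter> at_least A y (Suc m))) has_sum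
      measure (completion (P y)) (\<Union>x\<in>{x. adj E y x}. S x \<inter> at_least A y (Suc m))) {x. adj E y x}"
    using S' by (intro completion_P.has_sum_measure_countable_UN) (auto simp: disjoint_family_on_def S_def)
  moreover have "AE \<omega> in P y. \<omega> \<in> (\<Union>x\<in>{x. adj E y x}. S x \<inter> at_least A y (Suc m)) \<longleftrightarrow>
      \<omega> \<in> at_least A y (Suc m)"
    using ex(2) AE_space by eventually_elim (auto simp: S_def T_def)
  then have "measure (completion (P y)) (\<Union>x\<in>{x. adj E y x}. S x \<inter> at_least A y (Suc m)) =
      measure (completion (P y)) (at_least A y (Suc m))"
    using S' sets_at_least
    by (intro measure_eq_AE sets.countable_UN') (auto simp: sets_P AE_completion_iff)
  ultimately have "((\<lambda>x. measure (completion (P y)) (S x \<inter> at_least A y (Suc m))) has_sum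
      measure (P y) (at_least A y (Suc m))) {x. adj E y x}"
    using sets_at_least by (simp add: sets_P)
  then show ?thesis
    by (rule has_sum_cong[THEN iffD1, rotated]) (simp add: prod)
qed

section \<open>Summing the geometric series\<close>

lemma green_eq_suminf:
  assumes A: "finite A" "A \<noteq> {}" "y \<notin> A"
  shows "green P A x y = (\<Sum>m. emeasure (P x) (at_least A y (Suc m)))"
proof -
  have "green P A x y = (\<integral>\<^sup>+\<omega>. visits A y \<omega> \<partial>P x)"
    by (simp add: green_def nn_integral_completion)
  also have "\<dots> = (\<integral>\<^sup>+\<omega>. (\<Sum>m. indicator (at_least A y (Suc m)) \<omega>) \<partial>P x)"
  proof (rule nn_integral_cong_AE)
    show "AE \<omega> in P x. visits A y \<omega> = (\<Sum>m. indicator (at_least A y (Suc m)) \<omega>)"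
      using hit_time_exists[OF A(1,2), of x] AE_regular_path[of y x] AE_space
    proof eventually_elim
      case (elim \<omega>)
      have "visits A y \<omega> = (\<Sum>m. if of_nat (Suc m) \<le> num_visits A y \<omega> then 1 else 0)"
        using visits_eq_num_visits[OF elim(2,1)] num_visits_eq_suminf by metis
      also have "\<dots> = (\<Sum>m. indicator (at_least A y (Suc m)) \<omega>)"
        using elim(3) by (intro suminf_cong) (simp add: at_least_def grid_visits_eq[OF elim(2) A(3)])
      finally show ?case .
    qed
  qed
  also have "\<dots> = (\<Sum>m. emeasure (P x) (at_least A y (Suc m)))"
    using sets_at_least by (subst nn_integral_suminf) (auto simp: sets_P intro!: borel_measurable_indicator)
  finally show ?thesis .
qed

text \<open>The two claims belong together because \<open>ennreal\<close> truncates negative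
  numbers. Nonnegativity of the kernel is obtained from the walk, the voltage being a
  probability.\<close>

lemma
  assumes A: "finite A" "A \<noteq> {}"
  shows green_eq_kernel: "green P A x y = ennreal (\<pi> y * kernel A x y)"
    and kernel_nonneg: "0 \<le> kernel A x y"
proof (atomize (full), cases "y \<in> A")
  case True
  have "AE \<omega> in P x. visits A y \<omega> = 0"
    using hit_time_exists[OF A, of x] AE_regular_path[of y x]
  proof eventually_elim
    case (elim \<omega>)
    have "visit_ends A y \<omega> = {}"
      using True unfolding visit_ends_def by force
    then show ?case
      using visits_eq_num_visits[OF elim(2,1)] by (simp add: num_visits_def)
  qed
  then have "(\<integral>\<^sup>+\<omega>. visits A y \<omega> \<partial>P x) = (\<integral>\<^sup>+\<omega>. 0 \<partial>P x)"
    by (rule nn_integral_cong_AE)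
  then show "green P A x y = ennreal (\<pi> y * kernel A x y) \<and> 0 \<le> kernel A x y"
    using True by (simp add: green_def nn_integral_completion kernel_def)
next
  case False
  note A' = A(1) False
  define a where "a m = measure (P y) (at_least A y m)" for m
  define h where "h = voltage A y"
  have hit: "measure (P z) (at_least A y (Suc m)) = h z * a (Suc m)" for z m
    unfolding h_def a_def by (rule measure_at_least_hit[OF A']) simp
  have exit: "((\<lambda>x. c {y, x} / \<pi> y * measure (P x) (at_least A y m)) has_sum a (Suc m)) {x. adj E y x}" for m
    unfolding a_def by (rule measure_at_least_exit[OF False])
  have "at_least A y 0 = space (P z)" for z
    by (simp add: at_least_def)
  then have "measure (P z) (at_least A y 0) = 1" for z
    by (metis P.prob_space)
  then have "((\<lambda>x. c {y, x} / \<pi> y) has_sum a (Suc 0)) {x. adj E y x}"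
    using exit[of 0] by simp
  \<comment> \<open>At least zero visits is a sure event, so the exit relation for
    \<open>m = 0\<close> merely adds up the jump probabilities: from \<open>y\<close> one visit is
    certain.\<close>
  then have a1: "a (Suc 0) = 1"
    using transition_has_sum has_sum_unique by blast
  \<comment> \<open>Two visits from \<open>y\<close> amount to one return. Inserting the hit
    relation into the exit relation gives first the formula for \<open>r\<close> and then the
    recursion.\<close>
  define r where "r = a (Suc (Suc 0))"
  have r: "((\<lambda>x. c {y, x} / \<pi> y * h x) has_sum r) {x. adj E y x}"
    using exit[of "Suc 0"] by (simp add: hit a1 r_def)
  have "a (Suc (Suc m)) = r * a (Suc m)" for m
  proof -
    have "((\<lambda>x. c {y, x} / \<pi> y * h x * a (Suc m)) has_sum r * a (Suc m)) {x. adj E y x}"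
      by (rule has_sum_cmult_left[OF r])
    then show ?thesis
      using exit[of "Suc m"] has_sum_unique by (fastforce simp: hit mult.assoc)
  qed
  then have a: "a (Suc m) = r ^ m" for m
    by (induction m) (simp_all add: a1)
  \<comment> \<open>The escape probability averages \<open>1 - h x\<close> over the jump from
    \<open>y\<close>; times \<open>\<pi> y\<close> it is the net current of
    \<open>eff_conductance_eq\<close>.\<close>
  have "((\<lambda>x. c {y, x} / \<pi> y - c {y, x} / \<pi> y * h x) has_sum 1 - r) {x. adj E y x}"
    using has_sum_add[OF transition_has_sum has_sum_cmult_right[OF r, of "-1"]] by simp
  then have "((\<lambda>x. \<pi> y * (c {y, x} / \<pi> y - c {y, x} / \<pi> y * h x)) has_sum \<pi> y * (1 - r)) {x. adj E y x}"
    by (rule has_sum_cmult_right)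
  moreover have "\<pi> y * (c {y, x} / \<pi> y - c {y, x} / \<pi> y * h x) = c {y, x} * (1 - h x)" for x
    using total_conductance_pos[of y] by (simp add: field_simps)
  ultimately have "((\<lambda>x. c {y, x} * (1 - h x)) has_sum \<pi> y * (1 - r)) {x. adj E y x}"
    by simp
  then have eff: "\<pi> y * (1 - r) = eff_conductance A y"
    unfolding eff_conductance_eq[OF A', symmetric] h_def by (rule infsumI[symmetric])
  have h0: "0 \<le> h x"
    using hit[of x 0] a1 measure_nonneg[of "P x" "at_least A y (Suc 0)"] by simp
  have r0: "0 \<le> r"
    by (simp add: r_def a_def)
  have r1: "r < 1"
    using eff_conductance_pos[OF A False] total_conductance_pos[of y]
    by (simp add: eff[symmetric] zero_less_mult_iff)
  have "green P A x y = (\<Sum>m. emeasure (P x) (at_least A y (Suc m)))"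
    by (rule green_eq_suminf[OF A False])
  also have "\<dots> = (\<Sum>m. ennreal (h x * r ^ m))"
    by (simp add: P.emeasure_eq_measure hit a)
  also have "\<dots> = ennreal (h x * (1 / (1 - r)))"
    using h0 r0 r1 by (intro suminf_ennreal_eq sums_mult geometric_sums) auto
  finally have "green P A x y = ennreal (h x * (1 / (1 - r)))" .
  moreover have kernel: "kernel A x y = h x / eff_conductance A y"
    using A' voltage_sink[OF A'] by (simp add: kernel_def h_def)
  then have "h x * (1 / (1 - r)) = \<pi> y * kernel A x y"
    using total_conductance_pos[of y] by (simp add: eff[symmetric])
  moreover have "0 \<le> kernel A x y"
    using kernel h0 eff_conductance_pos[OF A False] by simp
  ultimately show "green P A x y = ennreal (\<pi> y * kernel A x y) \<and> 0 \<le> kernel A x y"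
    by simp
qed

end

theorem lemma5p8:
  fixes E :: "'v::countable set set" and c :: "'v set \<Rightarrow> real"
    and w :: "'v \<Rightarrow> real" and F :: "'v path measure" and P :: "'v \<Rightarrow> 'v path measure"
    and A :: "'v set"
  assumes "infinite (UNIV :: 'v set)"
    and "conductance_graph E c"
    and "connected_graph E"
    and "\<forall>x. finite_conductance_at E c x"
    and "reflected_walk E c w F P"
    and "A \<noteq> {}" and "finite A"
  shows "(\<forall>x y. green P A x y < \<infinity>) \<and>
    (\<forall>x y. green P A x y / ennreal (total_conductance E c y) =
            green P A y x / ennreal (total_conductance E c x)) \<and>
    (\<forall>f :: 'v \<Rightarrow> real. finite {x. f x \<noteq> 0} \<longrightarrow>
       0 \<le> (\<Sum>\<^sub>\<infinity>(x, y)\<in>UNIV. f x * f y * (enn2real (green P A x y) / total_conductance E c y)))"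
proof -
  interpret reflected_walk E c w F P
    by fact
  interpret reflected_network E c w F P
    by unfold_locales (use assms in auto)
  note A = \<open>finite A\<close> \<open>A \<noteq> {}\<close>
  note nonneg = kernel_nonneg[OF A]
  \<comment> \<open>Division in \<open>ennreal\<close> agrees with real division since
    \<open>\<pi> y\<close> is positive and the kernel nonnegative; the reversibility claim is then
    the symmetry of the kernel.\<close>
  have quotient: "green P A x y / ennreal (\<pi> y) = ennreal (kernel A x y)" for x y
    using total_conductance_pos[of y] nonneg[of x y]
    by (simp add: green_eq_kernel[OF A] divide_ennreal)
  have "enn2real (green P A x y) / \<pi> y = kernel A x y" for x y
    using total_conductance_pos[of y] nonneg[of x y] by (simp add: green_eq_kernel[OF A])
  moreover have "0 \<le> (\<Sum>\<^sub>\<infinity>(x, y)\<in>UNIV. f x * f y * kernel A x y)" if "finite {x. f x \<noteq> 0}" for f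
  proof -
    define S where "S = {x. f x \<noteq> 0}"
    have "(\<Sum>\<^sub>\<infinity>(x, y)\<in>UNIV. f x * f y * kernel A x y) = (\<Sum>\<^sub>\<infinity>(x, y)\<in>S \<times> S. f x * f y * kernel A x y)"
      by (rule infsum_cong_neutral) (auto simp: S_def)
    also have "\<dots> = (\<Sum>x\<in>S. \<Sum>y\<in>S. f x * f y * kernel A x y)"
      using that by (simp add: S_def sum.cartesian_product)
    also have "\<dots> \<ge> 0"
      by (rule kernel_nonneg_definite[OF A])
    finally show ?thesis .
  qed
  moreover have "green P A x y < \<infinity>" for x y
    by (simp add: green_eq_kernel[OF A])
  moreover have "green P A x y / ennreal (\<pi> y) = green P A y x / ennreal (\<pi> x)" for x y
    unfolding quotient by (simp add: kernel_symmetric[OF A, of x y])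
  ultimately show ?thesis
    by simp
qed

end
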